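(* Consider the SFBF algorithm described in the context under the assumptions (A1)–(A7) listed there, with constant step size $\alpha_n=\alpha\in(0,\frac1{\sqrt2L})$ for all $n\ge0$. Let $x^*\in\mathcal X_*$ be arbitrary, put $\hat\sigma(x^* ):=\max\{\sigma(x^* ),\sigma_0\}$ and $\mathtt a(x^* ):=\hat\sigma(x^* )^2\alpha^2C_2^2\mathtt c_1$. Choose $\phi\in(0,\frac{\sqrt5-1}2)$ and let $n_0=n_0(x^* )$ be the first integer $\geq 0$ such that $\sum_{i\ge n_0}\frac1{m_{i+1}}\le\frac{\phi}{\mathtt a(x^* )}$. Let $\rho:=1-2\alpha^2L^2$, $\delta_n(x^* ):=\|X_n-x^*\|^2$, $\Gamma_n:=\sum_{i=0}^n\frac1{m_{i+1}}$, $\Gamma^{(2)}_n:=\sum_{i=0}^n\frac1{m_{i+1}^2}$, $$H(x^*,n,\phi):=\frac{1+\max_{0\le i\le n}\mathbb E[\delta_i(x^* )]}{1-\phi-\phi^2},$$ $$\Lambda_n(x^*,\phi):=\frac2\rho\Big\{\mathbb E[\delta_0(x^* )]+\big(1+H(x^*,n_0,\phi)\big)\big(\mathtt a(x^* )\Gamma_n+\mathtt a(x^* )^2\Gamma^{(2)}_n\big)\Big\},\qquad \Lambda_\infty(x^*,\phi):=\sup_{n\ge0}\Lambda_n(x^*,\phi).$$ For $\varepsilon>0$ define $N_\varepsilon:=\inf\{n\ge0:\mathbb E[r_\alpha(X_n)^2]\le\varepsilon\}$. Then, for every $\varepsilon>0$, either $N_\varepsilon=0$, or $$\mathbb E[r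_\alpha(X_{N_\varepsilon})^2]\le\varepsilon<\frac{\Lambda_\infty(x^*,\phi)}{N_\varepsilon}.$$
   Context: Notation: $\langle\cdot,\cdot\rangle$ and $\|\cdot\|$ are the Euclidean inner product and norm on $\mathbb R^d$; $\Pi_{E}$ is the Euclidean projection onto a nonempty closed convex set $E$. Problem: $\mathcal X\subseteq\mathbb R^d$; $(\Omega,\mathcal F,\mathbb P)$ is a probability space; $\xi$ is a random variable with values in a measurable space $(\Xi,\mathcal A)$ and law $\mathsf P$; $F:\mathbb R^d\times\Xi\to\mathbb R^d$ is such that $F(x,\xi)$ is integrable for each $x$; $T(x):=\mathbb E[F(x,\xi)]$. The solution set is $\mathcal X_*:=\{x^*\in\mathcal X:\langle T(x^* ),x-x^*\rangle\ge 0\ \forall x\in\mathcal X\}$. Assumptions. (A1) $\mathcal X_*\neq\emptyset$. (A2) $\mathcal X$ is nonempty, closed and convex, and $F$ is a Carathéodory map ($F(\cdot,z)$ is continuous for a.e. $z$ and $F(x,\cdot)$ is measurable for all $x$). (A3) $T$ is Lipschitz continuous on $\mathbb R^d$ with modulus $L>0$. (A4) $T$ is pseudo-monotone on $\mathbb R^d$: for all $x,y\in\mathbb R^d$, $\langle T(x),y-x\rangle\ge0$ implies $\langle T(y),y-x\rangle\ge 0$. (A5) The step sizes satisfy $0<\inf_{n\ge0}\alpha_n\le\sup_{n\ge0}\alpha_n<\frac1{\sqrt2L}$ (automatic for the constant step size $\alpha$). (A6) The batch sizes $m_n$ ($n\ge1$) are positive integers with $\sum_{n\ge1}1/m_n<\infty$.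 (A7) There exist $p\ge2$, $\sigma_0\ge0$ and a measurable locally bounded function $\sigma:\mathcal X_*\to[0,\infty)$ such that for all $x\in\mathbb R^d$ and $x^*\in\mathcal X_*$: $\mathbb E[\|F(x,\xi)-T(x)\|^p]^{1/p}\le\sigma(x^* )+\sigma_0\|x-x^*\|$. SFBF algorithm: $X_0$ is an $\mathbb R^d$-valued random vector; for $n\ge1$, $\xi_n=(\xi_n^{(1)},\dots,\xi_n^{(m_n)})$ and $\eta_n=(\eta_n^{(1)},\dots,\eta_n^{(m_n)})$, where all the $\xi_n^{(i)},\eta_n^{(i)}$ are i.i.d. with law $\mathsf P$ and independent of $X_0$. For $n\ge0$: $A_{n+1}=\frac1{m_{n+1}}\sum_{i=1}^{m_{n+1}}F(X_n,\xi_{n+1}^{(i)})$, $Y_n=\Pi_{\mathcal X}(X_n-\alpha_nA_{n+1})$, $B_{n+1}=\frac1{m_{n+1}}\sum_{i=1}^{m_{n+1}}F(Y_n,\eta_{n+1}^{(i)})$, $X_{n+1}=Y_n+\alpha_n(A_{n+1}-B_{n+1})$. Residual: for $a>0$, $r_a(x):=\|x-\Pi_{\mathcal X}(x-aT(x))\|$. Constants: for $q\ge1$, $C_q>0$ is a universal (Burkholder–Davis–Gundy) constant such that $\mathbb E[\sup_{0\le i\le N}\|U_i\|^q]^{1/q}\le C_q\,\mathbb E[(\sum_{i=1}^N\|U_i-U_{i-1}\|^2)^{q/2}]^{1/q}$ for every $N\ge1$ and every vector-valued martingale $(U_i)$ with $U_0=0$. With $\kappa_n:=\alpha^2C_2^2\big[2(4+\rho)+16\big(1+\alpha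 L+\alpha\sigma_0C_2/\sqrt{m_{n+1}}\big)^2\big]$, $\mathtt c_1>1$ is a fixed constant such that $\kappa_n\le\alpha^2C_2^2\mathtt c_1\big[1+\alpha^2\sigma_0^2C_2^2/m_{n+1}\big]$ for all $n\ge0$. Convention: $\phi/0=+\infty$.
   Formalization: If E[δ_0(x* )] is infinite, N_ε can be infinite and X_{N_ε} undefined; the formal theorem proves that N_ε is finite when E[δ_0(x* )] is finite, and proves the displayed bound whenever N_ε is finite, with no further hypothesis. *)

theory Defs
  imports "HOL-Probability.Probability"
begin

text \<open>
  All moments are taken with the \<open>[0,\<infinity>]\<close>-valued integral, so that an infinite expectation is
  \<open>\<infinity>\<close> and not the default value of the Bochner integral. The map below is the \<open>q\<close>-th root
  on \<open>[0,\<infinity>]\<close>.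
\<close>

definition enn_root :: "real \<Rightarrow> ennreal \<Rightarrow> ennreal" where
  "enn_root q t = (if t = \<infinity> then \<infinity> else ennreal (enn2real t powr (1 / q)))"

definition vi_solutions :: "('v::euclidean_space) set \<Rightarrow> ('v \<Rightarrow> 'v) \<Rightarrow> 'v set" where
  "vi_solutions C T = {s \<in> C. \<forall>x\<in>C. T s \<bullet> (x - s) \<ge> 0}"

definition pseudo_monotone :: "('v::euclidean_space \<Rightarrow> 'v) \<Rightarrow> bool" where
  "pseudo_monotone T \<longleftrightarrow> (\<forall>x y. T x \<bullet> (y - x) \<ge> 0 \<longrightarrow> T y \<bullet> (y - x) \<ge> 0)"

definition locally_bounded_on :: "('v::metric_space) set \<Rightarrow> ('v \<Rightarrow> real) \<Rightarrow> bool" where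
  "locally_bounded_on S f \<longleftrightarrow> (\<forall>x\<in>S. \<exists>r>0. bounded (f ` (S \<inter> ball x r)))"

definition residual :: "('v::euclidean_space) set \<Rightarrow> ('v \<Rightarrow> 'v) \<Rightarrow> real \<Rightarrow> 'v \<Rightarrow> real" where
  "residual C T a x = norm (x - closest_point C (x - a *\<^sub>R T x))"

text \<open>
  Discrete-time martingales with values in a Euclidean space. The conditional expectation
  \<open>E[U\<^sub>i\<^sub>+\<^sub>1 | G\<^sub>i]\<close> is taken coordinatewise.
\<close>

definition vector_martingale ::
  "'a measure \<Rightarrow> (nat \<Rightarrow> 'a measure) \<Rightarrow> (nat \<Rightarrow> 'a \<Rightarrow> 'v::euclidean_space) \<Rightarrow> bool" where
  "vector_martingale M G U \<longleftrightarrow>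
     (\<forall>i. subalgebra M (G i)) \<and> (\<forall>i. subalgebra (G (Suc i)) (G i)) \<and>
     (\<forall>i. U i \<in> borel_measurable (G i)) \<and> (\<forall>i. integrable M (U i)) \<and>
     (\<forall>i. \<forall>b\<in>Basis. AE \<omega> in M. real_cond_exp M (G i) (\<lambda>\<omega>. U (Suc i) \<omega> \<bullet> b) \<omega> = U i \<omega> \<bullet> b)"

text \<open>
  \<open>C\<close> is a Burkholder--Davis--Gundy constant of order \<open>q\<close>. HOL cannot quantify over types inside
  a formula, so the sample spaces range over all probability spaces on the type \<open>'a\<close> and the
  values lie in \<open>'v\<close>; a constant that is universal in the usual sense has this property for
  every choice of \<open>'a\<close> and \<open>'v\<close>, so assuming only this property is the weaker hypothesis.
\<close>

definition bdg_constant ::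
  "'a itself \<Rightarrow> 'v::euclidean_space itself \<Rightarrow> real \<Rightarrow> real \<Rightarrow> bool" where
  "bdg_constant _ _ q C \<longleftrightarrow> C > 0 \<and>
     (\<forall>(M :: 'a measure) G (U :: nat \<Rightarrow> 'a \<Rightarrow> 'v) N.
        prob_space M \<and> vector_martingale M G U \<and> (\<forall>\<omega>\<in>space M. U 0 \<omega> = 0) \<and> N \<ge> 1 \<longrightarrow>
        enn_root q (\<integral>\<^sup>+\<omega>. ennreal ((SUP i\<in>{0..N}. norm (U i \<omega>)) powr q) \<partial>M)
        \<le> ennreal C *
          enn_root q (\<integral>\<^sup>+\<omega>. ennreal ((\<Sum>i=1..N. (norm (U i \<omega> - U (i - 1) \<omega>))\<^sup>2) powr (q / 2)) \<partial>M))"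

definition kappa :: "real \<Rightarrow> real \<Rightarrow> real \<Rightarrow> real \<Rightarrow> (nat \<Rightarrow> nat) \<Rightarrow> nat \<Rightarrow> real" where
  "kappa \<alpha> L \<sigma>0 C2 m n =
     (let \<rho> = 1 - 2 * \<alpha>\<^sup>2 * L\<^sup>2
      in \<alpha>\<^sup>2 * C2\<^sup>2 *
         (2 * (4 + \<rho>) + 16 * (1 + \<alpha> * L + \<alpha> * \<sigma>0 * C2 / sqrt (real (m (n + 1))))\<^sup>2))"

text \<open>
  \<open>first_index a \<phi> m\<close> is \<open>n\<^sub>0\<close>. In \<open>ennreal\<close> one has \<open>\<phi> / 0 = \<infinity>\<close> for \<open>\<phi> > 0\<close>.
\<close>

definition first_index :: "real \<Rightarrow> real \<Rightarrow> (nat \<Rightarrow> nat) \<Rightarrow> nat" where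
  "first_index a \<phi> m =
     (LEAST n. ennreal (\<Sum>i. 1 / real (m (n + i + 1))) \<le> ennreal \<phi> / ennreal a)"

text \<open>In the next definitions \<open>D i\<close> stands for \<open>E[\<delta>\<^sub>i(x\<^sup>*)] \<in> [0,\<infinity>]\<close>.\<close>

definition H_bound :: "(nat \<Rightarrow> ennreal) \<Rightarrow> nat \<Rightarrow> real \<Rightarrow> ennreal" where
  "H_bound D n \<phi> = (1 + Max (D ` {0..n})) / ennreal (1 - \<phi> - \<phi>\<^sup>2)"

definition Lambda_bound ::
  "real \<Rightarrow> real \<Rightarrow> (nat \<Rightarrow> nat) \<Rightarrow> (nat \<Rightarrow> ennreal) \<Rightarrow> real \<Rightarrow> nat \<Rightarrow> ennreal" where
  "Lambda_bound \<rho> a m D \<phi> n =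
     (let \<Gamma> = (\<Sum>i=0..n. 1 / real (m (i + 1)));
          \<Gamma>2 = (\<Sum>i=0..n. 1 / (real (m (i + 1)))\<^sup>2)
      in ennreal (2 / \<rho>) *
         (D 0 + (1 + H_bound D (first_index a \<phi> m) \<phi>) * ennreal (a * \<Gamma> + a\<^sup>2 * \<Gamma>2)))"

definition Lambda_sup ::
  "real \<Rightarrow> real \<Rightarrow> (nat \<Rightarrow> nat) \<Rightarrow> (nat \<Rightarrow> ennreal) \<Rightarrow> real \<Rightarrow> ennreal" where
  "Lambda_sup \<rho> a m D \<phi> = (SUP n. Lambda_bound \<rho> a m D \<phi> n)"

text \<open>
  The infimum lives in \<open>enat\<close>, so that it is \<open>\<infinity>\<close> if the level \<open>\<epsilon>\<close> is never reached. This does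
  happen if \<open>E[\<delta>\<^sub>0(x\<^sup>*)] = \<infinity>\<close> (deterministic linear \<open>F\<close> with a heavy-tailed starting point), so
  the theorem can claim finiteness only when \<open>E[\<delta>\<^sub>0(x\<^sup>*)] < \<infinity>\<close>.
\<close>

definition hitting_index :: "(nat \<Rightarrow> ennreal) \<Rightarrow> real \<Rightarrow> enat" where
  "hitting_index R \<epsilon> = Inf (enat ` {n. R n \<le> ennreal \<epsilon>})"

end

theory Submission
  imports Defs
begin

text \<open>
  Let \<open>W = A - T X\<close> and \<open>Z = B - T Y\<close> be the two sampling errors of a step. The variational
  inequality of the projection, pseudo-monotonicity (which discards \<open>T Y \<bullet> (Y - p) \<ge> 0\<close>) and the
  Lipschitz bound on \<open>T X - T Y\<close> give, for every realisation and every solution \<open>p\<close>, an energy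
  inequality (\<open>fbf_step_energy\<close>): the squared distance to \<open>p\<close> decreases by \<open>\<rho> / 2\<close> times the
  squared residual, up to a term linear in \<open>Z \<bullet> (Y - p)\<close> and multiples of \<open>(norm W)\<^sup>2\<close> and
  \<open>(norm Z)\<^sup>2\<close>.

  In expectation the linear term vanishes, since the samples behind \<open>Z\<close> are independent of \<open>Y\<close>.
  For the same reason the errors of the single samples in a batch are orthogonal in
  \<open>L\<^sup>2\<close>, so that a batch of size \<open>k\<close> divides the variance by \<open>k\<close> (\<open>minibatch_mean_error\<close>). As the
  variance grows at most quadratically in the distance to \<open>p\<close>, the numbers
  \<open>d n = E[(norm (X n - p))\<^sup>2]\<close> satisfy (\<open>sfbf_expected_energy\<close>)
  \<open>d (n + 1) + \<rho> / 2 * E[r\<^sup>2] \<le> d n + b n * (1 + d n)\<close> with \<open>b n = u n + (u n)\<^sup>2\<close> and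
  \<open>u n = a / m (n + 1)\<close>.

  The rest is about real sequences (\<open>hitting_index_bound\<close>). Beyond \<open>n\<^sub>0\<close> the perturbations \<open>b n\<close> add up
  to at most \<open>\<phi> + \<phi>\<^sup>2 < 1\<close>, so the recursion can be absorbed into its own maximum and
  \<open>d\<close> is bounded by \<open>H\<close>. Telescoping then bounds the sum of the residuals before
  \<open>N\<close> by \<open>\<Lambda>\<close>; if all of them exceed \<open>\<epsilon>\<close>, then \<open>N * \<epsilon> < \<Lambda>\<close>.

  Two points concern measurability. First, \<open>F\<close> is continuous in \<open>x\<close> only for almost every sample,
  so the iterates need not be measurable. Setting \<open>F\<close> to zero on the exceptional null set
  makes it jointly measurable, and almost surely does not change the iterates, because
  only countably many samples are drawn. Second, independence of the past is expressed
  through the \<open>\<sigma>\<close>-algebras \<open>history\<close> generated by the initial point and any set of samples.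
\<close>

section \<open>Caratheodory maps and second moments\<close>

text \<open>
  Replacing \<open>x\<close> by the first point of a countable dense set within distance \<open>1 / Suc n\<close> yields
  a function that takes countably many values in its first argument and is therefore jointly
  measurable; continuity in \<open>x\<close> gives convergence as \<open>n\<close> grows.
\<close>

lemma borel_measurable_caratheodory:
  fixes f :: "'b::{second_countable_topology, metric_space} \<Rightarrow> 'z \<Rightarrow> 'c::metric_space"
  assumes cont: "\<And>z. z \<in> space S \<Longrightarrow> continuous_on UNIV (\<lambda>x. f x z)"
    and meas: "\<And>x. f x \<in> borel_measurable S"
  shows "(\<lambda>(x, z). f x z) \<in> borel_measurable (borel \<Otimes>\<^sub>M S)"
proof -
  obtain D :: "'b set" where D: "countable D" "\<And>X. open X \<Longrightarrow> X \<noteq> {} \<Longrightarrow> \<exists>d\<in>D. d \<in> X"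
    using countable_dense_setE by blast
  then have "D \<noteq> {}"
    by (metis UNIV_not_empty empty_iff open_UNIV)
  define d where "d = from_nat_into D"
  define q where "q n x = (LEAST k. dist (d k) x < 1 / Suc n)" for n :: nat and x
  have near: "dist (d (q n x)) x < 1 / Suc n" for n x
  proof -
    obtain e where "e \<in> D" "e \<in> ball x (1 / Suc n)"
      using D(2)[of "ball x (1 / Suc n)"] by auto
    then have "\<exists>k. dist (d k) x < 1 / Suc n"
      unfolding d_def using from_nat_into_surj[OF D(1)] by (metis mem_ball dist_commute)
    then show ?thesis
      unfolding q_def by (rule LeastI_ex)
  qed
  have q_meas: "q n \<in> measurable borel (count_space UNIV)" for n
    unfolding q_def
  proof (rule measurable_Least)
    fix i
    have "{x. dist (d i) x < 1 / real (Suc n)} \<in> sets borel"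
      using borel_open[OF open_ball[of "d i" "1 / real (Suc n)"]] by (simp only: ball_def)
    then show "Measurable.pred borel (\<lambda>x. dist (d i) x < 1 / real (Suc n))"
      by (simp only: pred_def space_borel UNIV_I simp_thms)
  qed
  have lim: "(\<lambda>n. d (q n x)) \<longlonglongrightarrow> x" for x
  proof (rule metric_LIMSEQ_I)
    fix r :: real assume "r > 0"
    then obtain N where N: "N \<noteq> 0" "inverse (real N) < r"
      using real_arch_inverse[of r] by auto
    have "dist (d (q n x)) x < r" if "n \<ge> N" for n
    proof -
      have "1 / real (Suc n) \<le> inverse (real N)"
        using that N(1) by (simp add: field_simps)
      then show ?thesis using near[of n x] N(2) by linarith
    qed
    then show "\<exists>N. \<forall>n\<ge>N. dist (d (q n x)) x < r" by blast
  qed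
  show ?thesis
  proof (rule borel_measurable_LIMSEQ_metric)
    fix n
    show "(\<lambda>w. f (d (q n (fst w))) (snd w)) \<in> borel_measurable (borel \<Otimes>\<^sub>M S)"
    proof (rule measurable_compose_countable[where f="\<lambda>k w. f (d k) (snd w)"])
      show "(\<lambda>w. f (d k) (snd w)) \<in> borel_measurable (borel \<Otimes>\<^sub>M S)" for k
        by (rule measurable_compose[OF measurable_snd meas])
      show "(\<lambda>w. q n (fst w)) \<in> measurable (borel \<Otimes>\<^sub>M S) (count_space UNIV)"
        by (rule measurable_compose[OF measurable_fst q_meas])
    qed
  next
    fix w :: "'b \<times> 'z" assume w: "w \<in> space (borel \<Otimes>\<^sub>M S)"
    have "continuous_on UNIV (\<lambda>x. f x (snd w))"
      using cont[of "snd w"] w by (auto simp: space_pair_measure)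
    then have "(\<lambda>n. f (d (q n (fst w))) (snd w)) \<longlonglongrightarrow> f (fst w) (snd w)"
      by (rule continuous_on_tendsto_compose[OF _ lim]) auto
    then show "(\<lambda>n. f (d (q n (fst w))) (snd w)) \<longlonglongrightarrow> (case w of (x, z) \<Rightarrow> f x z)"
      by (simp add: case_prod_beta)
  qed
qed

text \<open>
  Young's inequality for \<open>(t / s)\<^sup>2\<close> and \<open>1\<close> with exponent \<open>p / 2\<close>. The right-hand side equals \<open>s\<^sup>2\<close>
  at \<open>t = s\<close>, so integrating it compares moments without loss of a constant.
\<close>

lemma power2_le_affine_powr:
  fixes t s p :: real
  assumes "p \<ge> 2" "t \<ge> 0" "s > 0"
  shows "t\<^sup>2 \<le> s\<^sup>2 * (1 - 2 / p) + (2 / p) * (s\<^sup>2 / s powr p) * t powr p"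
proof (cases "p = 2")
  case True
  then show ?thesis using assms by (simp add: powr_numeral)
next
  case False
  define r where "r = p / 2"
  have r: "r > 1" "1 - 1 / r > 0" using assms False by (auto simp: r_def)
  define q where "q = 1 / (1 - 1 / r)"
  have "(t / s)\<^sup>2 * 1 \<le> ((t / s)\<^sup>2) powr r / r + 1 powr q / q"
    using r by (intro Youngs_inequality) (auto simp: q_def)
  also have "((t / s)\<^sup>2) powr r = (t / s) powr p"
    using assms by (cases "t = 0") (auto simp: r_def powr_powr simp flip: powr_numeral)
  also have "(t / s) powr p = t powr p / s powr p"
    using assms by (simp add: powr_divide)
  finally have "(t / s)\<^sup>2 \<le> t powr p / s powr p * (2 / p) + (1 - 2 / p)"
    using r by (simp add: q_def r_def)
  then have "s\<^sup>2 * (t / s)\<^sup>2 \<le> s\<^sup>2 * (t powr p / s powr p * (2 / p) + (1 - 2 / p))"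
    by (rule mult_left_mono) simp
  then show ?thesis using assms by (simp add: power_divide algebra_simps)
qed

lemma le_powr_if_enn_root_le:
  assumes "enn_root p t \<le> ennreal s" "p > 0" "s \<ge> 0"
  shows "t \<le> ennreal (s powr p)"
proof -
  have fin: "t \<noteq> \<infinity>" using assms(1) by (auto simp: enn_root_def top_unique split: if_splits)
  then have "enn2real t powr (1 / p) \<le> s"
    using assms by (simp add: enn_root_def)
  then have "(enn2real t powr (1 / p)) powr p \<le> s powr p"
    using assms by (intro powr_mono2) auto
  then have "enn2real t \<le> s powr p"
    using assms by (simp add: powr_powr)
  then show ?thesis using fin
    by (metis ennreal_enn2real ennreal_leI infinity_ennreal_def less_top)
qed

lemma (in prob_space) second_moment_le_moment:
  assumes [measurable]: "f \<in> borel_measurable M" and nn: "\<And>\<omega>. f \<omega> \<ge> 0"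
    and p: "p \<ge> 2" and s: "s \<ge> 0"
    and le: "enn_root p (\<integral>\<^sup>+\<omega>. ennreal (f \<omega> powr p) \<partial>M) \<le> ennreal s"
  shows "(\<integral>\<^sup>+\<omega>. ennreal ((f \<omega>)\<^sup>2) \<partial>M) \<le> ennreal (s\<^sup>2)"
proof -
  have le': "(\<integral>\<^sup>+\<omega>. ennreal (f \<omega> powr p) \<partial>M) \<le> ennreal (s powr p)"
    using le_powr_if_enn_root_le[OF le] p s by simp
  show ?thesis
  proof (cases "s = 0")
    case True
    with le' have "AE \<omega> in M. ennreal (f \<omega> powr p) = 0"
      using nn_integral_0_iff_AE[of "\<lambda>\<omega>. ennreal (f \<omega> powr p)" M] by simp
    then have "AE \<omega> in M. ennreal ((f \<omega>)\<^sup>2) = 0"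
      by eventually_elim (use nn in \<open>auto simp: ennreal_eq_0_iff\<close>)
    then have "(\<integral>\<^sup>+\<omega>. ennreal ((f \<omega>)\<^sup>2) \<partial>M) = (\<integral>\<^sup>+\<omega>. 0 \<partial>M)"
      by (rule nn_integral_cong_AE)
    then show ?thesis by simp
  next
    case False
    with s have s: "s > 0" by simp
    define c where "c = (2 / p) * (s\<^sup>2 / s powr p)"
    have c: "c \<ge> 0" using p by (simp add: c_def)
    have "(\<integral>\<^sup>+\<omega>. ennreal ((f \<omega>)\<^sup>2) \<partial>M)
        \<le> (\<integral>\<^sup>+\<omega>. ennreal (s\<^sup>2 * (1 - 2 / p)) + ennreal c * ennreal (f \<omega> powr p) \<partial>M)"
    proof (rule nn_integral_mono)
      fix \<omega>
      show "ennreal ((f \<omega>)\<^sup>2) \<le> ennreal (s\<^sup>2 * (1 - 2 / p)) + ennreal c * ennreal (f \<omega> powr p)"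
        using power2_le_affine_powr[OF p nn s, of \<omega>] c p
        by (simp add: c_def flip: ennreal_mult ennreal_plus)
    qed
    also have "\<dots> = ennreal (s\<^sup>2 * (1 - 2 / p)) + ennreal c * (\<integral>\<^sup>+\<omega>. ennreal (f \<omega> powr p) \<partial>M)"
      by (simp add: nn_integral_add nn_integral_cmult emeasure_space_1)
    also have "\<dots> \<le> ennreal (s\<^sup>2 * (1 - 2 / p)) + ennreal c * ennreal (s powr p)"
      by (intro add_left_mono mult_left_mono le') simp
    also have "\<dots> = ennreal (s\<^sup>2 * (1 - 2 / p) + c * s powr p)"
      using c p by (simp flip: ennreal_mult ennreal_plus)
    also have "s\<^sup>2 * (1 - 2 / p) + c * s powr p = s\<^sup>2"
      using s p by (simp add: c_def field_simps)
    finally show ?thesis .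
  qed
qed

text \<open>The simplest martingale: one centred jump after a deterministic start.\<close>

lemma (in prob_space) vector_martingale_one_step:
  fixes Z :: "'a \<Rightarrow> 'v::euclidean_space"
  assumes Z: "integrable M Z" "expectation Z = 0"
  shows "vector_martingale M (\<lambda>i. if i = 0 then sigma (space M) {} else M)
           (\<lambda>i. if i = 0 then (\<lambda>\<omega>. 0) else Z)"
proof -
  let ?T = "sigma (space M) {}"
  have T: "subalgebra M ?T"
    by (auto simp: subalgebra_def sigma_sets_empty_eq)
  have triv: "finite_measure_subalgebra M ?T" and full: "finite_measure_subalgebra M M"
    using T by (auto simp: finite_measure_subalgebra_def finite_measure_subalgebra_axioms_def
        finite_measure_axioms subalgebra_def)
  interpret T: finite_measure_subalgebra M ?T by (rule triv)
  interpret N: finite_measure_subalgebra M M by (rule full)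
  have intb: "integrable M (\<lambda>\<omega>. Z \<omega> \<bullet> b)" for b
    using Z by (intro integrable_inner_left) auto
  have "AE \<omega> in M. real_cond_exp M ?T (\<lambda>\<omega>. Z \<omega> \<bullet> b) \<omega> = 0" for b
  proof (rule T.real_cond_exp_charact)
    fix A assume "A \<in> sets ?T"
    then have "A = {} \<or> A = space M"
      by (auto simp: sigma_sets_empty_eq)
    moreover have "(\<integral> x \<in> space M. Z x \<bullet> b \<partial>M) = 0"
      using Z by (subst set_integral_space[OF intb]) simp
    ultimately show "(\<integral> x \<in> A. Z x \<bullet> b \<partial>M) = (\<integral> x \<in> A. 0 \<partial>M)"
      by (auto simp: set_lebesgue_integral_def)
  qed (auto intro: intb)
  moreover have "AE \<omega> in M. real_cond_exp M M (\<lambda>\<omega>. Z \<omega> \<bullet> b) \<omega> = Z \<omega> \<bullet> b" for b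
    using intb by (intro N.real_cond_exp_F_meas) auto
  ultimately show ?thesis
    using Z T by (auto simp: vector_martingale_def subalgebra_def )
qed

text \<open>
  For the martingale \<open>0, Z, Z, \<dots>\<close> both sides of the Burkholder--Davis--Gundy inequality of order
  two have the same second moment \<open>e\<close>, so that \<open>e \<le> C\<^sup>2 * e\<close>: either \<open>C \<ge> 1\<close> or \<open>Z\<close> vanishes almost
  surely. Hence a bound on the variance of a single sample may always be multiplied by \<open>C\<^sup>2\<close>,
  even where \<open>C < 1\<close>.
\<close>

lemma (in prob_space) second_moment_le_bdg:
  fixes Z :: "'a \<Rightarrow> 'v::euclidean_space"
  assumes C: "bdg_constant TYPE('a) TYPE('v) 2 C"
    and Z: "integrable M Z" "expectation Z = 0"
    and fin: "(\<integral>\<^sup>+\<omega>. ennreal ((norm (Z \<omega>))\<^sup>2) \<partial>M) \<le> ennreal v" and v: "v \<ge> 0"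
  shows "(\<integral>\<^sup>+\<omega>. ennreal ((norm (Z \<omega>))\<^sup>2) \<partial>M) \<le> ennreal (C\<^sup>2 * v)"
proof -
  let ?U = "\<lambda>i. if i = 0 then (\<lambda>\<omega>. 0) else Z"
  define e where "e = (\<integral>\<^sup>+\<omega>. ennreal ((norm (Z \<omega>))\<^sup>2) \<partial>M)"
  have "C > 0" using C by (simp add: bdg_constant_def)
  have "enn_root 2 (\<integral>\<^sup>+\<omega>. ennreal ((SUP i\<in>{0..1::nat}. norm (?U i \<omega>)) powr 2) \<partial>M)
      \<le> ennreal C * enn_root 2 (\<integral>\<^sup>+\<omega>. ennreal ((\<Sum>i=1..1::nat. (norm (?U i \<omega> - ?U (i - 1) \<omega>))\<^sup>2) powr (2 / 2)) \<partial>M)"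
    using C[unfolded bdg_constant_def, THEN conjunct2, rule_format,
        OF conjI[OF prob_space_axioms conjI[OF vector_martingale_one_step[OF Z]]], of 1]
    by simp
  moreover have "(SUP i\<in>{0..1::nat}. norm (?U i \<omega>)) = norm (Z \<omega>)" for \<omega>
  proof -
    have "{0..1::nat} = {0, 1}" by auto
    then show ?thesis by (simp add: cSup_eq_Max)
  qed
  ultimately have root: "enn_root 2 e \<le> ennreal C * enn_root 2 e"
    by (simp add: e_def powr_numeral)
  obtain x where x: "e = ennreal x" "x \<ge> 0" "x \<le> v"
    using fin v unfolding e_def[symmetric] by (cases e) (auto simp: top_unique)
  have "ennreal (sqrt x) \<le> ennreal (C * sqrt x)"
    using root x \<open>C > 0\<close> by (simp add: enn_root_def ennreal_mult powr_half_sqrt)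
  then have "sqrt x \<le> C * sqrt x"
    using \<open>C > 0\<close> x by (subst (asm) ennreal_le_iff) auto
  then have "(sqrt x)\<^sup>2 \<le> (C * sqrt x)\<^sup>2"
    using x by (intro power_mono) auto
  then have "x \<le> C\<^sup>2 * x"
    using x by (simp add: power_mult_distrib)
  also have "\<dots> \<le> C\<^sup>2 * v" using x by (intro mult_left_mono) auto
  finally show ?thesis using x by (simp add: e_def[symmetric] ennreal_leI)
qed

section \<open>One forward-backward-forward step\<close>

text \<open>
  Expand the square around \<open>Y\<close> and use three facts: the projection makes
  \<open>(X - \<alpha> *\<^sub>R (T X + W) - Y) \<bullet> (p - Y)\<close> nonpositive, pseudo-monotonicity transfers the variational
  inequality from \<open>p\<close> to \<open>Y\<close>, and the step size leaves the positive fraction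
  \<open>\<rho> = 1 - 2 * \<alpha>\<^sup>2 * L\<^sup>2\<close> of \<open>(norm (X - Y))\<^sup>2\<close> after the Lipschitz bound. That fraction controls
  the residual, because \<open>Y\<close> differs from the noise-free projection by at most \<open>\<alpha> * norm W\<close>.
\<close>

lemma fbf_step_energy:
  fixes T :: "'v::euclidean_space \<Rightarrow> 'v"
  assumes C: "closed C" "convex C"
    and p: "p \<in> vi_solutions C T" and pm: "pseudo_monotone T"
    and L: "L-lipschitz_on UNIV T" and \<alpha>: "\<alpha> > 0" "2 * \<alpha>\<^sup>2 * L\<^sup>2 < 1"
    and Y: "Y = closest_point C (X - \<alpha> *\<^sub>R (T X + W))"
    and X': "X' = Y + \<alpha> *\<^sub>R ((T X + W) - (T Y + Z))"
  shows "(norm (X' - p))\<^sup>2 + (1 - 2 * \<alpha>\<^sup>2 * L\<^sup>2) / 2 * (residual C T \<alpha> X)\<^sup>2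
       \<le> (norm (X - p))\<^sup>2 - 2 * \<alpha> * (Z \<bullet> (Y - p))
           + (4 + (1 - 2 * \<alpha>\<^sup>2 * L\<^sup>2)) * \<alpha>\<^sup>2 * (norm W)\<^sup>2 + 4 * \<alpha>\<^sup>2 * (norm Z)\<^sup>2"
proof -
  define \<rho> where "\<rho> = 1 - 2 * \<alpha>\<^sup>2 * L\<^sup>2"
  have \<rho>: "\<rho> > 0" using \<alpha> by (simp add: \<rho>_def)
  have pC: "p \<in> C" and psol: "\<And>x. x \<in> C \<Longrightarrow> T p \<bullet> (x - p) \<ge> 0"
    using p by (auto simp: vi_solutions_def)
  have ne: "C \<noteq> {}" using pC by auto
  have YC: "Y \<in> C" unfolding Y by (rule closest_point_in_set[OF C(1) ne])
  have proj: "(X - \<alpha> *\<^sub>R (T X + W) - Y) \<bullet> (p - Y) \<le> 0"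
    unfolding Y by (rule closest_point_dot[OF C(2,1) pC])
  have mono: "T Y \<bullet> (Y - p) \<ge> 0"
    using pm psol[OF YC] by (simp add: pseudo_monotone_def)
  define N where "N = (T X + W) - (T Y + Z)"
  have "(norm (X' - p))\<^sup>2 = (norm (X - p))\<^sup>2 - (norm (X - Y))\<^sup>2 - 2 * \<alpha> * ((T Y + Z) \<bullet> (Y - p))
      + \<alpha>\<^sup>2 * (norm N)\<^sup>2 + 2 * ((X - \<alpha> *\<^sub>R (T X + W) - Y) \<bullet> (p - Y))"
    unfolding X' N_def power2_norm_eq_inner
    by (simp add: algebra_simps inner_simps inner_commute power2_eq_square)
  \<comment> \<open>Discard the projection term and \<open>T Y \<bullet> (Y - p)\<close>; both have the favourable sign.\<close>
  also have "\<dots> \<le> (norm (X - p))\<^sup>2 - (norm (X - Y))\<^sup>2 - 2 * \<alpha> * (Z \<bullet> (Y - p)) + \<alpha>\<^sup>2 * (norm N)\<^sup>2"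
  proof -
    have "0 \<le> \<alpha> * (T Y \<bullet> (Y - p))" using mono \<alpha> by simp
    then show ?thesis using proj
      by (simp add: inner_add_left distrib_left)
  qed
  finally have 1: "(norm (X' - p))\<^sup>2
      \<le> (norm (X - p))\<^sup>2 - (norm (X - Y))\<^sup>2 - 2 * \<alpha> * (Z \<bullet> (Y - p)) + \<alpha>\<^sup>2 * (norm N)\<^sup>2" .
  have par: "(norm (u + v))\<^sup>2 \<le> 2 * (norm u)\<^sup>2 + 2 * (norm v)\<^sup>2" for u v :: 'v
  proof -
    have "(norm (u + v))\<^sup>2 + (norm (u - v))\<^sup>2 = 2 * (norm u)\<^sup>2 + 2 * (norm v)\<^sup>2"
      unfolding power2_norm_eq_inner by (simp add: inner_simps inner_commute)
    then show ?thesis using zero_le_power2[of "norm (u - v)"] by linarith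
  qed
  have "(norm N)\<^sup>2 \<le> 2 * (norm (T X - T Y))\<^sup>2 + 2 * (norm (W + (- Z)))\<^sup>2"
    using par[of "T X - T Y" "W + (- Z)"] by (simp add: N_def algebra_simps)
  moreover have "(norm (W + (- Z)))\<^sup>2 \<le> 2 * (norm W)\<^sup>2 + 2 * (norm Z)\<^sup>2"
    using par[of W "- Z"] by simp
  moreover have "(norm (T X - T Y))\<^sup>2 \<le> (L * norm (X - Y))\<^sup>2"
    using L by (intro power_mono) (auto simp: lipschitz_on_def dist_norm)
  ultimately have "(norm N)\<^sup>2 \<le> 2 * L\<^sup>2 * (norm (X - Y))\<^sup>2 + 4 * (norm W)\<^sup>2 + 4 * (norm Z)\<^sup>2"
    by (simp add: power_mult_distrib)
  then have 2: "\<alpha>\<^sup>2 * (norm N)\<^sup>2 \<le> \<alpha>\<^sup>2 * (2 * L\<^sup>2 * (norm (X - Y))\<^sup>2 + 4 * (norm W)\<^sup>2 + 4 * (norm Z)\<^sup>2)"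
    by (rule mult_left_mono) simp
  have "dist (closest_point C (X - \<alpha> *\<^sub>R (T X + W))) (closest_point C (X - \<alpha> *\<^sub>R T X)) \<le> \<alpha> * norm W"
    using closest_point_lipschitz[OF C(2,1) ne, of "X - \<alpha> *\<^sub>R (T X + W)" "X - \<alpha> *\<^sub>R T X"] \<alpha>
    by (simp add: dist_norm algebra_simps)
  then have "residual C T \<alpha> X \<le> norm (X - Y) + \<alpha> * norm W"
    unfolding residual_def Y[symmetric] dist_norm
    using norm_triangle_ineq[of "X - Y" "Y - closest_point C (X - \<alpha> *\<^sub>R T X)"] by simp
  moreover have "residual C T \<alpha> X \<ge> 0" by (simp add: residual_def)
  ultimately have "(residual C T \<alpha> X)\<^sup>2 \<le> (norm (X - Y) + \<alpha> * norm W)\<^sup>2"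
    by (intro power_mono)
  also have "\<dots> \<le> 2 * (norm (X - Y))\<^sup>2 + 2 * \<alpha>\<^sup>2 * (norm W)\<^sup>2"
    using sum_squares_bound[of "norm (X - Y)" "\<alpha> * norm W"]
    by (simp add: power2_sum power_mult_distrib algebra_simps)
  finally have "\<rho> / 2 * (residual C T \<alpha> X)\<^sup>2 \<le> \<rho> / 2 * (2 * (norm (X - Y))\<^sup>2 + 2 * \<alpha>\<^sup>2 * (norm W)\<^sup>2)"
    using \<rho> by (intro mult_left_mono) auto
  also have "\<dots> = (norm (X - Y))\<^sup>2 - \<alpha>\<^sup>2 * (2 * L\<^sup>2 * (norm (X - Y))\<^sup>2) + \<rho> * \<alpha>\<^sup>2 * (norm W)\<^sup>2"
    by (simp add: \<rho>_def field_simps)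
  finally show ?thesis
    using 1 2 unfolding \<rho>_def[symmetric] by (simp add: distrib_left distrib_right)
qed

lemma vi_solution_fixed_point:
  assumes C: "closed C" "convex C" and p: "p \<in> vi_solutions C T" and \<alpha>: "\<alpha> \<ge> 0"
  shows "closest_point C (p - \<alpha> *\<^sub>R T p) = p"
proof (rule closest_point_unique[symmetric, OF C(2,1)])
  show "p \<in> C" using p by (simp add: vi_solutions_def)
  show "\<forall>z\<in>C. dist (p - \<alpha> *\<^sub>R T p) p \<le> dist (p - \<alpha> *\<^sub>R T p) z"
  proof
    fix z assume "z \<in> C"
    then have "0 \<le> \<alpha> * (T p \<bullet> (z - p))" using p \<alpha> by (simp add: vi_solutions_def)
    moreover have "(norm (p - \<alpha> *\<^sub>R T p - z))\<^sup>2
        = (norm (p - z))\<^sup>2 + 2 * (\<alpha> * (T p \<bullet> (z - p))) + (norm (\<alpha> *\<^sub>R T p))\<^sup>2"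
      unfolding power2_norm_eq_inner by (simp add: inner_simps inner_commute algebra_simps)
    moreover have "0 \<le> (norm (p - z))\<^sup>2" by simp
    ultimately have "(norm (\<alpha> *\<^sub>R T p))\<^sup>2 \<le> (norm (p - \<alpha> *\<^sub>R T p - z))\<^sup>2" by linarith
    then have "norm (\<alpha> *\<^sub>R T p) \<le> norm (p - \<alpha> *\<^sub>R T p - z)"
      by (rule power2_le_imp_le) simp
    then show "dist (p - \<alpha> *\<^sub>R T p) p \<le> dist (p - \<alpha> *\<^sub>R T p) z"
      by (simp add: dist_norm)
  qed
qed

text \<open>
  The solution is a fixed point of the noise-free half step, and projections are
  nonexpansive, so the distance of \<open>Y\<close> to \<open>p\<close> is at most that of the unprojected points. This
  turns a bound on the variance at \<open>Y\<close> into one at \<open>X\<close>.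
\<close>

lemma fbf_half_step_growth:
  fixes T :: "'v::euclidean_space \<Rightarrow> 'v"
  assumes C: "closed C" "convex C" and p: "p \<in> vi_solutions C T"
    and L: "L-lipschitz_on UNIV T" and \<alpha>: "\<alpha> \<ge> 0"
    and Y: "Y = closest_point C (X - \<alpha> *\<^sub>R (T X + W))"
  shows "norm (Y - p) \<le> (1 + \<alpha> * L) * norm (X - p) + \<alpha> * norm W"
proof -
  have ne: "C \<noteq> {}" using p by (auto simp: vi_solutions_def)
  have "norm (Y - p) = dist Y (closest_point C (p - \<alpha> *\<^sub>R T p))"
    by (simp add: vi_solution_fixed_point[OF C p \<alpha>] dist_norm)
  also have "\<dots> \<le> dist (X - \<alpha> *\<^sub>R (T X + W)) (p - \<alpha> *\<^sub>R T p)"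
    unfolding Y by (rule closest_point_lipschitz[OF C(2,1) ne])
  also have "\<dots> = norm ((X - p) - \<alpha> *\<^sub>R (T X - T p) - \<alpha> *\<^sub>R W)"
    by (simp add: dist_norm algebra_simps)
  also have "\<dots> \<le> norm (X - p) + \<alpha> * norm (T X - T p) + \<alpha> * norm W"
    using norm_triangle_ineq4[of "(X - p) - \<alpha> *\<^sub>R (T X - T p)" "\<alpha> *\<^sub>R W"]
      norm_triangle_ineq4[of "X - p" "\<alpha> *\<^sub>R (T X - T p)"] \<alpha> by simp
  also have "\<dots> \<le> norm (X - p) + \<alpha> * (L * norm (X - p)) + \<alpha> * norm W"
    using L \<alpha> by (intro add_mono mult_left_mono) (auto simp: lipschitz_on_def dist_norm)
  finally show ?thesis by (simp add: algebra_simps)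
qed

text \<open>
  \<open>EW\<close> and \<open>EZ\<close> stand for the second moments of the two errors. The bound on \<open>EZ\<close> loses a factor two,
  because the distance of \<open>Y\<close> to the solution is split as \<open>(x + y)\<^sup>2 \<le> 2 * x\<^sup>2 + 2 * y\<^sup>2\<close>; this is
  exactly what the coefficient 16 in \<open>kappa\<close> allows for.
\<close>

lemma noise_coefficient_bound:
  fixes \<alpha> L \<sigma>0 C2 c1 \<sigma>h d EW EZ :: real
  assumes kap: "kappa \<alpha> L \<sigma>0 C2 m n \<le> \<alpha>\<^sup>2 * C2\<^sup>2 * c1 * (1 + \<alpha>\<^sup>2 * \<sigma>0\<^sup>2 * C2\<^sup>2 / real (m (n + 1)))"
    and k: "k = m (n + 1)" "k \<ge> 1" and c: "C2 > 0" and c1: "c1 \<ge> 1"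
    and \<alpha>: "\<alpha> > 0" and L: "L > 0" "2 * \<alpha>\<^sup>2 * L\<^sup>2 < 1" and s: "\<sigma>0 \<ge> 0" "\<sigma>h \<ge> \<sigma>0" and d: "d \<ge> 0"
    and EW: "EW \<le> C2\<^sup>2 * (2 * \<sigma>h\<^sup>2 * (1 + d)) / k"
    and EZ: "EZ \<le> C2\<^sup>2 * (4 * \<sigma>h\<^sup>2 * (1 + \<alpha> * L)\<^sup>2 * (1 + d) + 2 * \<alpha>\<^sup>2 * \<sigma>0\<^sup>2 * EW) / k"
    and a: "a = \<sigma>h\<^sup>2 * \<alpha>\<^sup>2 * C2\<^sup>2 * c1"
  shows "(4 + (1 - 2 * \<alpha>\<^sup>2 * L\<^sup>2)) * \<alpha>\<^sup>2 * EW + 4 * \<alpha>\<^sup>2 * EZ \<le> (a / k + (a / k)\<^sup>2) * (1 + d)"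
proof -
  define \<rho> where "\<rho> = 1 - 2 * \<alpha>\<^sup>2 * L\<^sup>2"
  have \<rho>: "\<rho> > 0" using L by (simp add: \<rho>_def)
  define P where "P = \<sigma>h\<^sup>2 * (1 + d) / k"
  have P: "P \<ge> 0" using d by (simp add: P_def)
  define q where "q = \<alpha> * \<sigma>0 * C2 / sqrt k"
  have q: "q \<ge> 0" "q\<^sup>2 = \<alpha>\<^sup>2 * \<sigma>0\<^sup>2 * C2\<^sup>2 / k"
    using \<alpha> s c by (simp_all add: q_def power_divide power_mult_distrib)
  define l where "l = 1 + \<alpha> * L"
  have l: "l \<ge> 0" using \<alpha> L by (simp add: l_def)
  have EW': "EW \<le> 2 * C2\<^sup>2 * P"
    using EW by (simp add: P_def field_simps)
  have "EZ \<le> C2\<^sup>2 * (4 * \<sigma>h\<^sup>2 * l\<^sup>2 * (1 + d)) / k + 2 * q\<^sup>2 * EW"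
    using EZ by (simp add: l_def q(2) field_simps add_divide_distrib)
  also have "\<dots> \<le> 4 * C2\<^sup>2 * l\<^sup>2 * P + 2 * q\<^sup>2 * (2 * C2\<^sup>2 * P)"
    using EW' by (intro add_mono mult_left_mono) (auto simp: P_def field_simps)
  also have "\<dots> = 4 * C2\<^sup>2 * P * (l\<^sup>2 + q\<^sup>2)" by (simp add: algebra_simps)
  also have "\<dots> \<le> 4 * C2\<^sup>2 * P * (l + q)\<^sup>2"
    using l q P by (intro mult_left_mono) (auto simp: power2_sum)
  finally have EZ': "EZ \<le> 4 * C2\<^sup>2 * P * (l + q)\<^sup>2" .
  have "(4 + \<rho>) * \<alpha>\<^sup>2 * EW + 4 * \<alpha>\<^sup>2 * EZ
      \<le> (4 + \<rho>) * \<alpha>\<^sup>2 * (2 * C2\<^sup>2 * P) + 4 * \<alpha>\<^sup>2 * (4 * C2\<^sup>2 * P * (l + q)\<^sup>2)"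
    using EW' EZ' \<rho> by (intro add_mono mult_left_mono) auto
  also have "\<dots> = P * kappa \<alpha> L \<sigma>0 C2 m n"
    by (simp add: kappa_def Let_def \<rho>_def l_def q_def k(1) algebra_simps)
  also have "\<dots> \<le> P * (\<alpha>\<^sup>2 * C2\<^sup>2 * c1 * (1 + q\<^sup>2))"
    using kap P by (intro mult_left_mono) (auto simp: q(2) k(1))
  also have "\<dots> = a / k * (1 + q\<^sup>2) * (1 + d)"
    by (simp add: a P_def)
  also have "\<dots> \<le> a / k * (1 + a / k) * (1 + d)"
  proof -
    have "\<sigma>0\<^sup>2 * 1 \<le> \<sigma>h\<^sup>2 * c1" using s c1 by (intro mult_mono power_mono) auto
    then have "(\<alpha>\<^sup>2 * C2\<^sup>2) * \<sigma>0\<^sup>2 \<le> (\<alpha>\<^sup>2 * C2\<^sup>2) * (\<sigma>h\<^sup>2 * c1)"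
      by (intro mult_left_mono) auto
    then have "q\<^sup>2 \<le> a / k" unfolding q(2) a by (intro divide_right_mono) (simp_all add: mult_ac)
    moreover have "a \<ge> 0" using c1 by (simp add: a)
    ultimately show ?thesis using d by (intro mult_right_mono mult_left_mono) auto
  qed
  also have "\<dots> = (a / k + (a / k)\<^sup>2) * (1 + d)" by (simp add: algebra_simps power2_eq_square)
  finally show ?thesis by (simp add: \<rho>_def)
qed

section \<open>From the recursion to the hitting index\<close>

text \<open>
  If \<open>H\<close> bounds the sequence up to \<open>n\<close>, then summing the recursion from \<open>n0\<close> gives
  \<open>d (Suc n) \<le> K + \<theta> * (1 + H)\<close> with \<open>K\<close> the maximum up to \<open>n0\<close>; the value \<open>H = (1 + K) / (1 - \<theta>)\<close> is
  large enough for the right-hand side to stay below \<open>H\<close>.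
\<close>

lemma perturbed_recursion_bounded:
  fixes d b :: "nat \<Rightarrow> real"
  assumes step: "\<And>n. d (Suc n) \<le> d n + b n * (1 + d n)"
    and d: "\<And>n. d n \<ge> 0" and b: "\<And>n. b n \<ge> 0"
    and tail: "\<And>n. (\<Sum>i=n0..<n. b i) \<le> \<theta>" and \<theta>: "\<theta> < 1"
  shows "d n \<le> (1 + Max (d ` {0..n0})) / (1 - \<theta>)"
proof -
  have \<theta>0: "\<theta> \<ge> 0" using tail[of n0] by simp
  define K where "K = Max (d ` {0..n0})"
  have K: "d i \<le> K" if "i \<le> n0" for i
    using that unfolding K_def by (intro Max_ge) auto
  have K0: "K \<ge> 0" using K[of 0] d[of 0] by linarith
  define H where "H = (1 + K) / (1 - \<theta>)"
  have H: "H \<ge> K" "K + \<theta> * (1 + H) \<le> H"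
  proof -
    have e: "H * (1 - \<theta>) = 1 + K" using \<theta> by (simp add: H_def)
    have "K * (1 - \<theta>) \<le> K" using K0 \<theta>0 by (simp add: algebra_simps)
    then show "H \<ge> K"
      using e \<theta> by (simp add: H_def le_divide_eq)
    show "K + \<theta> * (1 + H) \<le> H" using e \<theta> by (simp add: algebra_simps)
  qed
  have "d n \<le> H \<and> (n0 \<le> n \<longrightarrow> d n \<le> K + (\<Sum>i=n0..<n. b i) * (1 + H))" for n
  proof (induction n)
    case 0
    then show ?case using K[of 0] H by auto
  next
    case (Suc n)
    show ?case
    proof (cases "Suc n \<le> n0")
      case True
      then show ?thesis using K[OF True] H by auto
    next
      case False
      then have n: "n0 \<le> n" by simp
      have "d (Suc n) \<le> d n + b n * (1 + d n)" by (rule step)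
      also have "\<dots> \<le> d n + b n * (1 + H)"
        using Suc b[of n] by (intro add_left_mono mult_left_mono) auto
      also have "\<dots> \<le> K + (\<Sum>i=n0..<n. b i) * (1 + H) + b n * (1 + H)"
        using Suc n by simp
      also have "\<dots> = K + (\<Sum>i=n0..<Suc n. b i) * (1 + H)"
        using n by (simp add: algebra_simps)
      finally have 1: "d (Suc n) \<le> K + (\<Sum>i=n0..<Suc n. b i) * (1 + H)" .
      also have "\<dots> \<le> K + \<theta> * (1 + H)"
        using tail[of "Suc n"] H K0 by (intro add_left_mono mult_right_mono) auto
      also note H(2)
      finally show ?thesis using 1 by simp
    qed
  qed
  then show ?thesis by (simp add: H_def K_def)
qed

lemma sum_telescoped_le:
  fixes d r b :: "nat \<Rightarrow> real"
  assumes step: "\<And>n. d (Suc n) + c * r n \<le> d n + b n * (1 + d n)"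
    and d: "\<And>n. 0 \<le> d n" "\<And>n. d n \<le> H" and b: "\<And>n. b n \<ge> 0"
  shows "c * (\<Sum>i<N. r i) \<le> d 0 + (1 + H) * (\<Sum>i<N. b i)"
proof -
  have "d N + c * (\<Sum>i<N. r i) \<le> d 0 + (1 + H) * (\<Sum>i<N. b i)"
  proof (induction N)
    case (Suc N)
    have "b N * (1 + d N) \<le> b N * (1 + H)"
      using d b by (intro mult_left_mono) auto
    with Suc step[of N] show ?case by (simp add: algebra_simps)
  qed simp
  with d(1)[of N] show ?thesis by linarith
qed

text \<open>
  The index is a \<open>LEAST\<close>, so its defining inequality is available only because the tails of the
  convergent series tend to zero. The product form also covers \<open>a = 0\<close>, where the quotient
  is infinite.
\<close>

lemma first_index_tail:
  assumes sm: "summable (\<lambda>n. 1 / real (m (n + 1)))" and a: "a \<ge> 0" and \<phi>: "\<phi> > 0"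
  shows "a * (\<Sum>i. 1 / real (m (first_index a \<phi> m + i + 1))) \<le> \<phi>"
proof -
  define u where "u n = 1 / real (m (n + 1))" for n
  have su: "summable u" using sm by (simp add: u_def[abs_def])
  define t where "t n = (\<Sum>i. u (n + i))" for n
  have t0: "t n \<ge> 0" for n
    using su summable_iff_shift[of u n] unfolding t_def
    by (intro suminf_nonneg) (auto simp: u_def add.commute)
  have iff: "ennreal (t n) \<le> ennreal \<phi> / ennreal a \<longleftrightarrow> a * t n \<le> \<phi>" for n
  proof (cases "a = 0")
    case True
    then show ?thesis using \<phi> by (simp add: ennreal_divide_zero)
  next
    case False
    then show ?thesis using a \<phi> t0[of n]
      by (simp add: divide_ennreal ennreal_le_iff pos_le_divide_eq mult.commute)
  qed
  have "t \<longlonglongrightarrow> 0"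
    using suminf_exist_split2[OF su] by (simp add: t_def[abs_def] add.commute)
  then have "(\<lambda>n. a * t n) \<longlonglongrightarrow> a * 0" by (intro tendsto_intros)
  then have "\<forall>\<^sub>F n in sequentially. a * t n < \<phi>"
    using \<phi> by (intro order_tendstoD) auto
  then obtain n where "a * t n \<le> \<phi>"
    by (auto simp: eventually_sequentially intro: less_imp_le)
  then have ex: "\<exists>n. ennreal (t n) \<le> ennreal \<phi> / ennreal a" using iff by blast
  have fi: "first_index a \<phi> m = (LEAST n. ennreal (t n) \<le> ennreal \<phi> / ennreal a)"
    by (simp add: first_index_def t_def u_def)
  have "ennreal (t (first_index a \<phi> m)) \<le> ennreal \<phi> / ennreal a"
    unfolding fi by (rule LeastI_ex[OF ex])
  then show ?thesis using iff by (simp add: t_def u_def)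
qed

lemma hitting_index_enat:
  assumes "hitting_index R \<epsilon> = enat N"
  shows "R N \<le> ennreal \<epsilon>" and "i < N \<Longrightarrow> ennreal \<epsilon> < R i"
proof -
  let ?S = "enat ` {n. R n \<le> ennreal \<epsilon>}"
  have "?S \<noteq> {}" using assms by (cases "?S = {}") (auto simp: hitting_index_def Inf_enat_def)
  then have "Inf ?S \<in> ?S" by (metis wellorder_InfI ex_in_conv)
  then show "R N \<le> ennreal \<epsilon>" using assms by (auto simp: hitting_index_def)
  assume i: "i < N"
  show "ennreal \<epsilon> < R i"
  proof (rule ccontr)
    assume "\<not> ennreal \<epsilon> < R i"
    then have "hitting_index R \<epsilon> \<le> enat i"
      unfolding hitting_index_def by (intro Inf_lower) (auto simp: not_less)
    with assms i show False by simp
  qed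
qed

text \<open>
  The recursion is stated in \<open>[0,\<infinity>]\<close> and is required only where \<open>D n\<close> is finite. If
  \<open>D 0 = \<infinity>\<close>, then \<open>\<Lambda>\<close> is infinite and the bound is trivial; otherwise finiteness propagates along
  the recursion, and everything takes place in the reals.
\<close>

lemma hitting_index_bound:
  fixes D R :: "nat \<Rightarrow> ennreal"
  assumes \<rho>: "\<rho> > 0" and a: "a \<ge> 0" and \<phi>: "\<phi> > 0" "\<phi> + \<phi>\<^sup>2 < 1" and \<epsilon>: "\<epsilon> > 0"
    and sm: "summable (\<lambda>n. 1 / real (m (n + 1)))"
    and step: "\<And>n. D n < \<infinity> \<Longrightarrow>
      D (Suc n) + ennreal (\<rho> / 2) * R n
      \<le> D n + ennreal (a / real (m (n + 1)) + (a / real (m (n + 1)))\<^sup>2) * (1 + D n)"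
  shows "D 0 < \<infinity> \<longrightarrow> hitting_index R \<epsilon> < \<infinity>"
    and "hitting_index R \<epsilon> = enat N \<Longrightarrow> N \<noteq> 0 \<Longrightarrow>
      ennreal \<epsilon> < Lambda_sup \<rho> a m D \<phi> / of_nat N"
proof -
  have "(D 0 < \<infinity> \<longrightarrow> hitting_index R \<epsilon> < \<infinity>) \<and>
    (\<forall>N. hitting_index R \<epsilon> = enat N \<longrightarrow> N \<noteq> 0 \<longrightarrow> ennreal \<epsilon> < Lambda_sup \<rho> a m D \<phi> / of_nat N)"
  proof (cases "D 0 = \<infinity>")
    case True
    have "Lambda_bound \<rho> a m D \<phi> 0 = \<infinity>"
      using \<rho> True by (simp add: Lambda_bound_def Let_def ennreal_mult_top)
    then have "Lambda_sup \<rho> a m D \<phi> = \<infinity>"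
      unfolding Lambda_sup_def by (metis SUP_upper UNIV_I infinity_ennreal_def top_unique)
    then show ?thesis using True
      by (simp add: ennreal_top_divide)
  next
    case fin0: False
    define u where "u n = a / real (m (n + 1))" for n
    define b where "b n = u n + (u n)\<^sup>2" for n
    have u0: "u n \<ge> 0" and b0: "b n \<ge> 0" for n using a by (simp_all add: u_def b_def)
    have finD: "D n < \<infinity>" for n
    proof (induction n)
      case 0 show ?case using fin0 by (simp add: less_top)
    next
      case (Suc n)
      have "D (Suc n) \<le> D (Suc n) + ennreal (\<rho> / 2) * R n" by simp
      also note step[OF Suc]
      also have "D n + ennreal (a / real (m (n + 1)) + (a / real (m (n + 1)))\<^sup>2) * (1 + D n) < \<infinity>"
        using Suc by (simp add: ennreal_mult_less_top)
      finally show ?case .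
    qed
    define d where "d n = enn2real (D n)" for n
    have Dd: "D n = ennreal (d n)" and d0: "d n \<ge> 0" for n
      using finD[of n] by (simp_all add: d_def)
    have bnd: "D (Suc n) + ennreal (\<rho> / 2) * R n \<le> ennreal (d n + b n * (1 + d n))" for n
    proof -
      have "D n + ennreal (b n) * (1 + D n) = ennreal (d n + b n * (1 + d n))"
        using d0[of n] b0[of n]
        by (simp add: Dd ennreal_mult[symmetric] ennreal_plus[symmetric] ennreal_1[symmetric]
            del: ennreal_plus ennreal_1)
      then show ?thesis using step[OF finD, of n] by (simp add: b_def u_def)
    qed
    define r where "r n = enn2real (R n)" for n
    have Rr: "R n = ennreal (r n)" and r0: "r n \<ge> 0" for n
    proof -
      have "ennreal (\<rho> / 2) * R n \<le> ennreal (d n + b n * (1 + d n))"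
        using bnd[of n] by (rule order_trans[rotated]) simp
      then have "ennreal (\<rho> / 2) * R n < \<infinity>"
        by (rule le_less_trans) simp
      then have "R n < \<infinity>" using \<rho> by (auto simp: ennreal_mult_less_top)
      then show "R n = ennreal (r n)" by (simp add: r_def)
    qed (simp add: r_def)
    have stepr: "d (Suc n) + \<rho> / 2 * r n \<le> d n + b n * (1 + d n)" for n
    proof -
      have "ennreal (d (Suc n) + \<rho> / 2 * r n) \<le> ennreal (d n + b n * (1 + d n))"
        using bnd[of n] d0[of "Suc n"] r0[of n] \<rho>
        by (simp add: Dd[of "Suc n"] Rr ennreal_mult[symmetric] ennreal_plus[symmetric] del: ennreal_plus)
      then show ?thesis using d0[of n] b0[of n] by (subst (asm) ennreal_le_iff) auto
    qed
    define n0 where "n0 = first_index a \<phi> m"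
    define \<theta> where "\<theta> = \<phi> + \<phi>\<^sup>2"
    define H where "H = (1 + Max (d ` {0..n0})) / (1 - \<theta>)"
    have su: "summable u" using summable_mult[OF sm, of a] by (simp add: u_def[abs_def])
    have tail: "(\<Sum>i=n0..<n. u i) \<le> \<phi>" for n
    proof -
      have s': "summable (\<lambda>i. u (n0 + i))"
        using su summable_iff_shift[of u n0] by (simp add: add.commute)
      have "(\<Sum>i=n0..<n. u i) = (\<Sum>i<n - n0. u (n0 + i))"
        by (rule sum.reindex_bij_witness[of _ "\<lambda>i. n0 + i" "\<lambda>i. i - n0"]) auto
      also have "\<dots> \<le> (\<Sum>i. u (n0 + i))"
        using u0 s' by (intro sum_le_suminf) auto
      also have "\<dots> = a * (\<Sum>i. 1 / real (m (n0 + i + 1)))"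
        using summable_iff_shift[of "\<lambda>n. 1 / real (m (n + 1))" n0] sm
        by (subst suminf_mult[symmetric]) (auto simp: u_def add_ac)
      also have "\<dots> \<le> \<phi>" unfolding n0_def by (rule first_index_tail[OF sm a \<phi>(1)])
      finally show ?thesis .
    qed
    \<comment> \<open>Each \<open>u i\<close> is at most the whole tail, hence at most \<open>\<phi>\<close>, so the squares add up to at most \<open>\<phi>\<^sup>2\<close>.\<close>
    have tailb: "(\<Sum>i=n0..<n. b i) \<le> \<theta>" for n
    proof -
      have "(u i)\<^sup>2 \<le> \<phi> * u i" if "i \<in> {n0..<n}" for i
      proof -
        have "u i \<le> (\<Sum>i=n0..<n. u i)" using that u0 by (intro member_le_sum) auto
        with tail[of n] have "u i \<le> \<phi>" by linarith
        then show ?thesis using u0[of i] by (simp add: power2_eq_square mult_right_mono)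
      qed
      then have "(\<Sum>i=n0..<n. (u i)\<^sup>2) \<le> \<phi> * (\<Sum>i=n0..<n. u i)"
        unfolding sum_distrib_left by (intro sum_mono)
      also have "\<dots> \<le> \<phi> * \<phi>" using tail \<phi> by (intro mult_left_mono) auto
      finally show ?thesis using tail[of n]
        by (simp add: b_def \<theta>_def sum.distrib power2_eq_square)
    qed
    have \<theta>1: "\<theta> < 1" using \<phi> by (simp add: \<theta>_def)
    have dH: "d n \<le> H" for n
      unfolding H_def
    proof (rule perturbed_recursion_bounded[OF _ d0 b0 tailb \<theta>1])
      fix n show "d (Suc n) \<le> d n + b n * (1 + d n)"
        using stepr[of n] mult_nonneg_nonneg[of "\<rho> / 2" "r n"] r0[of n] \<rho> by linarith
    qed
    have H0: "H \<ge> 0" using dH[of 0] d0[of 0] by linarith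
    have Hb: "H_bound D n0 \<phi> = ennreal H"
    proof -
      have "Max (D ` {0..n0}) = ennreal (Max (d ` {0..n0}))"
        using mono_Max_commute[of ennreal "d ` {0..n0}"]
        by (simp add: image_image Dd[abs_def] mono_def ennreal_leI)
      moreover have "Max (d ` {0..n0}) \<ge> 0"
        by (rule order_trans[OF d0[of 0] Max_ge]) auto
      ultimately show ?thesis
        using \<theta>1 by (simp add: H_bound_def H_def \<theta>_def divide_ennreal diff_diff_add
            flip: ennreal_1 ennreal_plus)
    qed
    define \<Lambda> where "\<Lambda> N = 2 / \<rho> * (d 0 + (1 + H) * (\<Sum>i<N. b i))" for N
    have Lam: "Lambda_bound \<rho> a m D \<phi> n = ennreal (\<Lambda> (Suc n))" for n
    proof -
      have s: "a * (\<Sum>i=0..n. 1 / real (m (i + 1))) + a\<^sup>2 * (\<Sum>i=0..n. 1 / (real (m (i + 1)))\<^sup>2)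
          = (\<Sum>i<Suc n. b i)"
        by (simp add: b_def u_def sum.distrib sum_distrib_left power_divide atLeast0AtMost
            lessThan_Suc_atMost del: sum.lessThan_Suc sum.atMost_Suc)
      have "(\<Sum>i<Suc n. b i) \<ge> 0" using b0 by (intro sum_nonneg) auto
      then show ?thesis
        unfolding Lambda_bound_def Let_def s n0_def[symmetric] Hb \<Lambda>_def Dd[of 0]
        using \<rho> d0[of 0] H0
        by (simp add: ennreal_mult[symmetric] ennreal_plus[symmetric] ennreal_1[symmetric]
            del: ennreal_plus ennreal_1 sum.lessThan_Suc)
    qed
    have key: "real N * \<epsilon> < \<Lambda> N" if N: "N \<noteq> 0" and big: "\<And>i. i < N \<Longrightarrow> ennreal \<epsilon> < R i" for N
    proof -
      have "\<epsilon> < r i" if "i < N" for i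
        using big[OF that] \<epsilon> by (simp add: Rr ennreal_less_iff)
      then have "(\<Sum>i<N. \<epsilon>) < (\<Sum>i<N. r i)"
        using N by (intro sum_strict_mono) auto
      moreover have "\<rho> / 2 * (\<Sum>i<N. r i) \<le> d 0 + (1 + H) * (\<Sum>i<N. b i)"
        by (rule sum_telescoped_le[of d "\<rho> / 2" r b H, OF stepr d0 dH b0])
      moreover from this have "(\<Sum>i<N. r i) \<le> \<Lambda> N" using \<rho> by (simp add: \<Lambda>_def field_simps)
      ultimately show ?thesis by simp
    qed
    \<comment> \<open>Summability makes \<open>\<Lambda>\<close> bounded, so \<open>N * \<epsilon> < \<Lambda> N\<close> fails for large \<open>N\<close>.\<close>
    have sb: "summable b"
    proof -
      have "summable (\<lambda>n. (u n)\<^sup>2)"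
      proof (rule summable_comparison_test_ev[OF _ su])
        have "\<forall>\<^sub>F n in sequentially. u n < 1"
          using summable_LIMSEQ_zero[OF su] by (intro order_tendstoD) auto
        then show "\<forall>\<^sub>F n in sequentially. norm ((u n)\<^sup>2) \<le> u n"
          by eventually_elim (use u0 in \<open>auto simp: power2_eq_square mult_left_le\<close>)
      qed
      then show ?thesis using su by (simp add: b_def[abs_def] summable_add)
    qed
    show ?thesis
    proof (intro conjI impI allI)
      show "hitting_index R \<epsilon> < \<infinity>"
      proof (rule ccontr)
        assume "\<not> hitting_index R \<epsilon> < \<infinity>"
        then have "ennreal \<epsilon> < R i" for i
          unfolding hitting_index_def
          by (metis (mono_tags, lifting) Inf_lower enat_ord_code(4) image_eqI le_less_trans linorder_not_le mem_Collect_eq)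
        then have "real N * \<epsilon> < \<Lambda> N" if "N \<noteq> 0" for N using key that by blast
        moreover have "\<Lambda> N \<le> 2 / \<rho> * (d 0 + (1 + H) * suminf b)" for N
          unfolding \<Lambda>_def using \<rho> H0 b0 sb
          by (intro mult_left_mono add_left_mono sum_le_suminf) auto
        ultimately have "real N * \<epsilon> < 2 / \<rho> * (d 0 + (1 + H) * suminf b)" if "N \<noteq> 0" for N
          using that by (meson less_le_trans)
        moreover obtain N where "2 / \<rho> * (d 0 + (1 + H) * suminf b) < real N * \<epsilon>"
          using reals_Archimedean3[OF \<epsilon>] by blast
        moreover have "2 / \<rho> * (d 0 + (1 + H) * suminf b) \<ge> 0"
          using \<rho> H0 b0 sb d0[of 0] by (intro mult_nonneg_nonneg add_nonneg_nonneg suminf_nonneg) auto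
        ultimately show False
          by (cases "N = 0") (auto dest: less_asym)
      qed
    next
      fix N assume h: "hitting_index R \<epsilon> = enat N" and N: "N \<noteq> 0"
      then obtain n where n: "N = Suc n" by (cases N) auto
      have "real N * \<epsilon> < \<Lambda> N" by (rule key[OF N hitting_index_enat(2)[OF h]])
      then have "\<epsilon> < \<Lambda> N / real N" using N by (simp add: field_simps)
      then have "ennreal \<epsilon> < ennreal (\<Lambda> N / real N)" using \<epsilon> by (simp add: ennreal_less_iff)
      also have "\<dots> = ennreal (\<Lambda> N) / of_nat N"
      proof -
        have "\<Lambda> N \<ge> 0"
          using \<open>real N * \<epsilon> < \<Lambda> N\<close> \<epsilon> mult_nonneg_nonneg[of "real N" \<epsilon>] by linarith
        then show ?thesis
          using N by (simp add: ennreal_of_nat_eq_real_of_nat divide_ennreal)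
      qed
      also have "\<dots> \<le> Lambda_sup \<rho> a m D \<phi> / of_nat N"
        unfolding Lambda_sup_def n Lam[symmetric]
        by (intro divide_right_mono_ennreal SUP_upper) auto
      finally show "ennreal \<epsilon> < Lambda_sup \<rho> a m D \<phi> / of_nat N" .
    qed
  qed
  then show "D 0 < \<infinity> \<longrightarrow> hitting_index R \<epsilon> < \<infinity>"
    and "hitting_index R \<epsilon> = enat N \<Longrightarrow> N \<noteq> 0 \<Longrightarrow>
      ennreal \<epsilon> < Lambda_sup \<rho> a m D \<phi> / of_nat N"
    by blast+
qed

section \<open>Samples independent of the past\<close>

context prob_space
begin

text \<open>
  Independence of a random variable from a \<open>\<sigma>\<close>-algebra is used instead of independence
  of two random variables, because it passes to everything measurable with respect to \<open>H\<close>,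
  whatever the type of its values.
\<close>

definition fresh :: "'a measure \<Rightarrow> 'z measure \<Rightarrow> ('a \<Rightarrow> 'z) \<Rightarrow> bool" where
  "fresh H S \<zeta> \<longleftrightarrow> subalgebra M H \<and> \<zeta> \<in> measurable M S \<and>
     indep_set (sets H) (sets (vimage_algebra (space M) \<zeta> S))"

lemma fresh_distr:
  assumes "fresh H S \<zeta>" "U \<in> measurable H N"
  shows "distr M N U \<Otimes>\<^sub>M distr M S \<zeta> = distr M (N \<Otimes>\<^sub>M S) (\<lambda>\<omega>. (U \<omega>, \<zeta> \<omega>))"
proof -
  have H: "subalgebra M H" and Z: "\<zeta> \<in> measurable M S"
    and ind: "indep_set (sets H) (sets (vimage_algebra (space M) \<zeta> S))"
    using assms(1) by (auto simp: fresh_def)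
  have sp: "space H = space M" using H by (simp add: subalgebra_def)
  have U: "U \<in> measurable M N" using measurable_from_subalg[OF H assms(2)] .
  interpret P: prob_space "distr M S \<zeta>" by (rule prob_space_distr[OF Z])
  interpret Q: prob_space "distr M N U" by (rule prob_space_distr[OF U])
  show ?thesis
  proof (rule pair_measure_eqI)
    fix A B assume "A \<in> sets (distr M N U)" "B \<in> sets (distr M S \<zeta>)"
    then have AB: "A \<in> sets N" "B \<in> sets S" by simp_all
    have a: "U -` A \<inter> space M \<in> sets H"
      using measurable_sets[OF assms(2) AB(1)] sp by simp
    have b: "\<zeta> -` B \<inter> space M \<in> sets (vimage_algebra (space M) \<zeta> S)"
      by (rule in_vimage_algebra[OF AB(2)])
    have "emeasure (distr M (N \<Otimes>\<^sub>M S) (\<lambda>\<omega>. (U \<omega>, \<zeta> \<omega>))) (A \<times> B)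
        = emeasure M ((U -` A \<inter> space M) \<inter> (\<zeta> -` B \<inter> space M))"
      using AB U Z by (subst emeasure_distr) (auto intro!: arg_cong[where f="emeasure M"])
    also have "\<dots> = emeasure M (U -` A \<inter> space M) * emeasure M (\<zeta> -` B \<inter> space M)"
      using indep_setD[OF ind a b] by (simp add: emeasure_eq_measure ennreal_mult)
    finally show "emeasure (distr M N U) A * emeasure (distr M S \<zeta>) B
        = emeasure (distr M (N \<Otimes>\<^sub>M S) (\<lambda>\<omega>. (U \<omega>, \<zeta> \<omega>))) (A \<times> B)"
      using AB U Z by (simp add: emeasure_distr)
  qed (auto intro: P.sigma_finite_measure Q.sigma_finite_measure
       simp: P.sigma_finite_measure_axioms Q.sigma_finite_measure_axioms)
qed

text \<open>
  The next two lemmas are the freezing principle: a quantity determined by the past is held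
  fixed while the fresh sample is integrated out.
\<close>

lemma nn_integral_fresh:
  fixes f :: "'b \<times> 'z \<Rightarrow> ennreal"
  assumes fr: "fresh H S \<zeta>" and UH: "U \<in> measurable H N" and f: "f \<in> borel_measurable (N \<Otimes>\<^sub>M S)"
  shows "(\<integral>\<^sup>+\<omega>. f (U \<omega>, \<zeta> \<omega>) \<partial>M) = (\<integral>\<^sup>+\<omega>. (\<integral>\<^sup>+z. f (U \<omega>, z) \<partial>distr M S \<zeta>) \<partial>M)"
proof -
  have Z: "\<zeta> \<in> measurable M S" using fr by (simp add: fresh_def)
  have U: "U \<in> measurable M N"
    using fr UH by (auto simp: fresh_def intro: measurable_from_subalg)
  note prod = fresh_distr[OF fr UH]
  interpret P: prob_space "distr M S \<zeta>" by (rule prob_space_distr[OF Z])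
  have f': "f \<in> borel_measurable (N \<Otimes>\<^sub>M distr M S \<zeta>)"
    using f measurable_cong_sets[OF sets_pair_measure_cong[of N N "distr M S \<zeta>" S] refl] by auto
  have "(\<integral>\<^sup>+\<omega>. f (U \<omega>, \<zeta> \<omega>) \<partial>M) = integral\<^sup>N (distr M N U \<Otimes>\<^sub>M distr M S \<zeta>) f"
    unfolding prod using U Z f by (subst nn_integral_distr) auto
  also have "\<dots> = (\<integral>\<^sup>+u. (\<integral>\<^sup>+z. f (u, z) \<partial>distr M S \<zeta>) \<partial>distr M N U)"
    using f by (intro P.nn_integral_fst[symmetric])
      (auto simp: measurable_cong_sets[OF sets_pair_measure_cong[of "distr M N U" N "distr M S \<zeta>" S] refl])
  also have "\<dots> = (\<integral>\<^sup>+\<omega>. (\<integral>\<^sup>+z. f (U \<omega>, z) \<partial>distr M S \<zeta>) \<partial>M)"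
    using U P.borel_measurable_nn_integral_fst[OF f'] by (subst nn_integral_distr) auto
  finally show ?thesis .
qed

lemma expectation_fresh_eq_0:
  fixes f :: "'b \<times> 'z \<Rightarrow> real"
  assumes fr: "fresh H S \<zeta>" and UH: "U \<in> measurable H N" and f: "f \<in> borel_measurable (N \<Otimes>\<^sub>M S)"
    and int: "integrable M (\<lambda>\<omega>. f (U \<omega>, \<zeta> \<omega>))"
    and zero: "\<And>u. u \<in> space N \<Longrightarrow> (\<integral>z. f (u, z) \<partial>distr M S \<zeta>) = 0"
  shows "expectation (\<lambda>\<omega>. f (U \<omega>, \<zeta> \<omega>)) = 0"
proof -
  have Z: "\<zeta> \<in> measurable M S" using fr by (simp add: fresh_def)
  have U: "U \<in> measurable M N"
    using fr UH by (auto simp: fresh_def intro: measurable_from_subalg)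
  note prod = fresh_distr[OF fr UH]
  interpret P: prob_space "distr M S \<zeta>" by (rule prob_space_distr[OF Z])
  interpret Q: prob_space "distr M N U" by (rule prob_space_distr[OF U])
  interpret PQ: pair_prob_space "distr M N U" "distr M S \<zeta>" ..
  have UZ: "(\<lambda>\<omega>. (U \<omega>, \<zeta> \<omega>)) \<in> measurable M (N \<Otimes>\<^sub>M S)"
    using U Z by auto
  have "integrable (distr M N U \<Otimes>\<^sub>M distr M S \<zeta>) f"
    unfolding prod using int by (subst integrable_distr_eq[OF UZ f])
  then have "(\<integral>u. (\<integral>z. f (u, z) \<partial>distr M S \<zeta>) \<partial>distr M N U)
      = integral\<^sup>L (distr M N U \<Otimes>\<^sub>M distr M S \<zeta>) f"
    by (rule PQ.integral_fst')
  also have "\<dots> = expectation (\<lambda>\<omega>. f (U \<omega>, \<zeta> \<omega>))"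
    unfolding prod by (rule integral_distr[OF UZ f])
  also have "(\<integral>u. (\<integral>z. f (u, z) \<partial>distr M S \<zeta>) \<partial>distr M N U) = (\<integral>u. 0 \<partial>distr M N U)"
    by (rule Bochner_Integration.integral_cong) (auto simp: zero)
  finally show ?thesis by simp
qed

text \<open>
  A kernel that is centred for every fixed \<open>x\<close> remains orthogonal to the past when \<open>x\<close> is
  replaced by a point that depends on the past, and its conditional variance is bounded by
  \<open>v\<close> at that point.
\<close>

lemma fresh_kernel_moments:
  fixes G :: "'v::euclidean_space \<Rightarrow> 'z \<Rightarrow> 'v"
  assumes fr: "fresh H S \<zeta>"
    and G: "(\<lambda>(x, z). G x z) \<in> borel_measurable (borel \<Otimes>\<^sub>M S)"
    and mean: "\<And>x. (\<integral>z. G x z \<partial>distr M S \<zeta>) = 0"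
    and var: "\<And>x. (\<integral>\<^sup>+z. ennreal ((norm (G x z))\<^sup>2) \<partial>distr M S \<zeta>) \<le> ennreal (v x)"
    and X: "X \<in> borel_measurable H"
    and v: "\<And>x. v x \<ge> 0" and vX: "integrable M (\<lambda>\<omega>. v (X \<omega>))"
  shows "integrable M (\<lambda>\<omega>. (norm (G (X \<omega>) (\<zeta> \<omega>)))\<^sup>2)"
    and "expectation (\<lambda>\<omega>. (norm (G (X \<omega>) (\<zeta> \<omega>)))\<^sup>2) \<le> expectation (\<lambda>\<omega>. v (X \<omega>))"
    and "U \<in> borel_measurable H \<Longrightarrow> integrable M (\<lambda>\<omega>. (norm (U \<omega>))\<^sup>2) \<Longrightarrow>
      integrable M (\<lambda>\<omega>. U \<omega> \<bullet> G (X \<omega>) (\<zeta> \<omega>)) \<and> expectation (\<lambda>\<omega>. U \<omega> \<bullet> G (X \<omega>) (\<zeta> \<omega>)) = 0"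
proof -
  let ?P = "distr M S \<zeta>"
  let ?G = "\<lambda>\<omega>. G (X \<omega>) (\<zeta> \<omega>)"
  have H: "subalgebra M H" and Z: "\<zeta> \<in> measurable M S"
    using fr by (auto simp: fresh_def)
  have XM[measurable]: "X \<in> borel_measurable M" using measurable_from_subalg[OF H X] .
  have XZ: "(\<lambda>\<omega>. (X \<omega>, \<zeta> \<omega>)) \<in> measurable M (borel \<Otimes>\<^sub>M S)" using XM Z by auto
  have GM[measurable]: "?G \<in> borel_measurable M"
    using measurable_compose[OF XZ G] by simp
  have G2: "(\<lambda>w. ennreal ((norm (case w of (x, z) \<Rightarrow> G x z))\<^sup>2)) \<in> borel_measurable (borel \<Otimes>\<^sub>M S)"
    using G by measurable
  have "(\<integral>\<^sup>+\<omega>. ennreal ((norm (?G \<omega>))\<^sup>2) \<partial>M)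
      = (\<integral>\<^sup>+\<omega>. (\<integral>\<^sup>+z. ennreal ((norm (G (X \<omega>) z))\<^sup>2) \<partial>?P) \<partial>M)"
    using nn_integral_fresh[OF fr X G2] by simp
  also have "\<dots> \<le> (\<integral>\<^sup>+\<omega>. ennreal (v (X \<omega>)) \<partial>M)"
    by (intro nn_integral_mono var)
  also have "\<dots> = ennreal (expectation (\<lambda>\<omega>. v (X \<omega>)))"
    by (rule nn_integral_eq_integral[OF vX]) (simp add: v)
  finally have le: "(\<integral>\<^sup>+\<omega>. ennreal ((norm (?G \<omega>))\<^sup>2) \<partial>M) \<le> ennreal (expectation (\<lambda>\<omega>. v (X \<omega>)))" .
  show int: "integrable M (\<lambda>\<omega>. (norm (?G \<omega>))\<^sup>2)"
    using le by (intro integrableI_bounded) (auto intro: le_less_trans)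
  have "expectation (\<lambda>\<omega>. v (X \<omega>)) \<ge> 0" by (simp add: v)
  then show "expectation (\<lambda>\<omega>. (norm (?G \<omega>))\<^sup>2) \<le> expectation (\<lambda>\<omega>. v (X \<omega>))"
    using le by (subst (asm) nn_integral_eq_integral[OF int]) auto
  assume U: "U \<in> borel_measurable H" and U2: "integrable M (\<lambda>\<omega>. (norm (U \<omega>))\<^sup>2)"
  have UM[measurable]: "U \<in> borel_measurable M" using measurable_from_subalg[OF H U] .
  have intUG: "integrable M (\<lambda>\<omega>. U \<omega> \<bullet> ?G \<omega>)"
  proof (rule Bochner_Integration.integrable_bound)
    show "integrable M (\<lambda>\<omega>. (norm (U \<omega>))\<^sup>2 + (norm (?G \<omega>))\<^sup>2)" using U2 int by simp
    show "AE \<omega> in M. norm (U \<omega> \<bullet> ?G \<omega>) \<le> norm ((norm (U \<omega>))\<^sup>2 + (norm (?G \<omega>))\<^sup>2)"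
    proof (intro always_eventually allI)
      fix \<omega>
      have "\<bar>U \<omega> \<bullet> ?G \<omega>\<bar> \<le> norm (U \<omega>) * norm (?G \<omega>)" by (rule Cauchy_Schwarz_ineq2)
      moreover have "0 \<le> norm (U \<omega>) * norm (?G \<omega>)" by simp
      moreover have "2 * norm (U \<omega>) * norm (?G \<omega>) \<le> (norm (U \<omega>))\<^sup>2 + (norm (?G \<omega>))\<^sup>2"
        by (rule sum_squares_bound)
      ultimately show "norm (U \<omega> \<bullet> ?G \<omega>) \<le> norm ((norm (U \<omega>))\<^sup>2 + (norm (?G \<omega>))\<^sup>2)"
        by simp
    qed
  qed measurable
  let ?f = "\<lambda>(w, z). fst w \<bullet> G (snd w) z"
  have UX: "(\<lambda>\<omega>. (U \<omega>, X \<omega>)) \<in> measurable H (borel \<Otimes>\<^sub>M borel)" using U X by auto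
  have f: "?f \<in> borel_measurable ((borel \<Otimes>\<^sub>M borel) \<Otimes>\<^sub>M S)"
  proof -
    have "(\<lambda>w. (snd (fst w), snd w)) \<in> measurable (((borel :: 'v measure) \<Otimes>\<^sub>M borel) \<Otimes>\<^sub>M S) (borel \<Otimes>\<^sub>M S)"
      by measurable
    from measurable_compose[OF this G]
    have "(\<lambda>w. G (snd (fst w)) (snd w)) \<in> borel_measurable (((borel :: 'v measure) \<Otimes>\<^sub>M borel) \<Otimes>\<^sub>M S)"
      by simp
    then show ?thesis unfolding case_prod_beta
      by (intro borel_measurable_inner) auto
  qed
  have "expectation (\<lambda>\<omega>. ?f ((U \<omega>, X \<omega>), \<zeta> \<omega>)) = 0"
  proof (rule expectation_fresh_eq_0[OF fr UX f])
    show "integrable M (\<lambda>\<omega>. ?f ((U \<omega>, X \<omega>), \<zeta> \<omega>))" using intUG by simp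
    fix w :: "'v \<times> 'v"
    have Gx: "(\<lambda>z. G (snd w) z) \<in> borel_measurable ?P"
      using measurable_compose[OF measurable_Pair1' G, of "snd w"] by simp
    interpret P: prob_space ?P by (rule prob_space_distr[OF Z])
    have "integrable ?P (\<lambda>z. (norm (G (snd w) z))\<^sup>2)"
      using var[of "snd w"] Gx by (intro integrableI_bounded) (auto intro: le_less_trans)
    then have "integrable ?P (\<lambda>z. 1 + (norm (G (snd w) z))\<^sup>2)" by simp
    then have "integrable ?P (\<lambda>z. G (snd w) z)"
    proof (rule Bochner_Integration.integrable_bound[OF _ Gx], intro always_eventually allI)
      fix z
      have "2 * norm (G (snd w) z) \<le> (norm (G (snd w) z))\<^sup>2 + 1"
        using sum_squares_bound[of "norm (G (snd w) z)" 1] by simp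
      moreover have "0 \<le> norm (G (snd w) z)" by simp
      ultimately have "norm (G (snd w) z) \<le> 1 + (norm (G (snd w) z))\<^sup>2" by linarith
      then show "norm (G (snd w) z) \<le> norm (1 + (norm (G (snd w) z))\<^sup>2)" by simp
    qed
    then show "(\<integral>z. ?f (w, z) \<partial>?P) = 0"
      using mean[of "snd w"] by simp
  qed
  with intUG show "integrable M (\<lambda>\<omega>. U \<omega> \<bullet> ?G \<omega>) \<and> expectation (\<lambda>\<omega>. U \<omega> \<bullet> ?G \<omega>) = 0"
    by simp
qed

text \<open>
  The partial sums form a square-integrable martingale for \<open>H\<close>: the error of each new sample is
  orthogonal to the partial sum before it, so the variances add up.
\<close>

lemma minibatch_moments:
  fixes G :: "'v::euclidean_space \<Rightarrow> 'z \<Rightarrow> 'v"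
  assumes fr: "\<forall>i\<in>{1..k}. fresh (H (i - 1)) S (\<zeta> i)"
    and mono: "\<And>i. subalgebra (H (Suc i)) (H i)"
    and meas: "\<forall>i\<in>{1..k}. \<zeta> i \<in> measurable (H i) S"
    and law: "\<forall>i\<in>{1..k}. distr M S (\<zeta> i) = P"
    and G: "(\<lambda>(x, z). G x z) \<in> borel_measurable (borel \<Otimes>\<^sub>M S)"
    and mean: "\<And>x. (\<integral>z. G x z \<partial>P) = 0"
    and var: "\<And>x. (\<integral>\<^sup>+z. ennreal ((norm (G x z))\<^sup>2) \<partial>P) \<le> ennreal (v x)"
    and X: "X \<in> borel_measurable (H 0)"
    and v: "\<And>x. v x \<ge> 0" and vX: "integrable M (\<lambda>\<omega>. v (X \<omega>))"
  defines "N \<equiv> \<lambda>j \<omega>. \<Sum>i=1..j. G (X \<omega>) (\<zeta> i \<omega>)"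
  shows "integrable M (\<lambda>\<omega>. (norm (N k \<omega>))\<^sup>2)"
    and "expectation (\<lambda>\<omega>. (norm (N k \<omega>))\<^sup>2) \<le> real k * expectation (\<lambda>\<omega>. v (X \<omega>))"
    and "U \<in> borel_measurable (H 0) \<Longrightarrow> integrable M (\<lambda>\<omega>. (norm (U \<omega>))\<^sup>2) \<Longrightarrow>
      integrable M (\<lambda>\<omega>. U \<omega> \<bullet> N k \<omega>) \<and> expectation (\<lambda>\<omega>. U \<omega> \<bullet> N k \<omega>) = 0"
proof -
  have up: "f \<in> measurable (H i) Q \<Longrightarrow> f \<in> measurable (H (i + j)) Q" for f i j and Q :: "'q measure"
    by (induction j) (auto intro: measurable_from_subalg[OF mono])
  have XH: "X \<in> borel_measurable (H i)" for i using up[OF X, of i] by simp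
  have GH: "(\<lambda>\<omega>. G (X \<omega>) (\<zeta> i \<omega>)) \<in> borel_measurable (H i)" if "i \<in> {1..k}" for i
    using measurable_compose[OF measurable_Pair[OF XH meas[rule_format, OF that]] G] by simp
  have all: "j \<le> k \<longrightarrow> N j \<in> borel_measurable (H j) \<and> integrable M (\<lambda>\<omega>. (norm (N j \<omega>))\<^sup>2) \<and>
    expectation (\<lambda>\<omega>. (norm (N j \<omega>))\<^sup>2) \<le> real j * expectation (\<lambda>\<omega>. v (X \<omega>)) \<and>
    (\<forall>U. U \<in> borel_measurable (H 0) \<longrightarrow> integrable M (\<lambda>\<omega>. (norm (U \<omega>))\<^sup>2) \<longrightarrow>
      integrable M (\<lambda>\<omega>. U \<omega> \<bullet> N j \<omega>) \<and> expectation (\<lambda>\<omega>. U \<omega> \<bullet> N j \<omega>) = 0)" for j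
  proof (induction j)
    case 0
    then show ?case by (simp add: N_def)
  next
    case (Suc j)
    show ?case
    proof
      assume "Suc j \<le> k"
      then have i: "Suc j \<in> {1..k}" by simp
      have IHm: "N j \<in> borel_measurable (H j)" and IHi: "integrable M (\<lambda>\<omega>. (norm (N j \<omega>))\<^sup>2)"
        and IHv: "expectation (\<lambda>\<omega>. (norm (N j \<omega>))\<^sup>2) \<le> real j * expectation (\<lambda>\<omega>. v (X \<omega>))"
        and IHo: "\<And>U. U \<in> borel_measurable (H 0) \<Longrightarrow> integrable M (\<lambda>\<omega>. (norm (U \<omega>))\<^sup>2) \<Longrightarrow>
          integrable M (\<lambda>\<omega>. U \<omega> \<bullet> N j \<omega>) \<and> expectation (\<lambda>\<omega>. U \<omega> \<bullet> N j \<omega>) = 0"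
        using Suc \<open>Suc j \<le> k\<close> by auto
      let ?g = "\<lambda>\<omega>. G (X \<omega>) (\<zeta> (Suc j) \<omega>)"
      have frj: "fresh (H j) S (\<zeta> (Suc j))" using fr[rule_format, OF i] by simp
      have km: "(\<integral>z. G x z \<partial>distr M S (\<zeta> (Suc j))) = 0"
        and kv: "(\<integral>\<^sup>+z. ennreal ((norm (G x z))\<^sup>2) \<partial>distr M S (\<zeta> (Suc j))) \<le> ennreal (v x)" for x
        using mean var by (simp_all add: law[rule_format, OF i])
      note g = fresh_kernel_moments[OF frj G km kv XH v vX]
      have N: "N (Suc j) \<omega> = N j \<omega> + ?g \<omega>" for \<omega> by (simp add: N_def)
      have sq: "(norm (N (Suc j) \<omega>))\<^sup>2 = (norm (N j \<omega>))\<^sup>2 + 2 * (N j \<omega> \<bullet> ?g \<omega>) + (norm (?g \<omega>))\<^sup>2" for \<omega>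
        unfolding N power2_norm_eq_inner by (simp add: inner_simps inner_commute)
      note cross = g(3)[OF IHm IHi]
      have 1: "N (Suc j) \<in> borel_measurable (H (Suc j))"
        unfolding N[abs_def] using up[OF IHm, of 1] GH[OF i] by simp
      have 2: "integrable M (\<lambda>\<omega>. (norm (N (Suc j) \<omega>))\<^sup>2)"
        unfolding sq using IHi cross g(1) by simp
      have 3: "expectation (\<lambda>\<omega>. (norm (N (Suc j) \<omega>))\<^sup>2) \<le> real (Suc j) * expectation (\<lambda>\<omega>. v (X \<omega>))"
        unfolding sq using IHi IHv cross g(1,2) by (simp add: algebra_simps)
      have 4: "integrable M (\<lambda>\<omega>. U \<omega> \<bullet> N (Suc j) \<omega>) \<and> expectation (\<lambda>\<omega>. U \<omega> \<bullet> N (Suc j) \<omega>) = 0"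
        if U: "U \<in> borel_measurable (H 0)" "integrable M (\<lambda>\<omega>. (norm (U \<omega>))\<^sup>2)" for U
        using IHo[OF U] g(3)[OF _ U(2)] up[OF U(1), of j] by (simp add: N inner_add_right)
      show "N (Suc j) \<in> borel_measurable (H (Suc j)) \<and> integrable M (\<lambda>\<omega>. (norm (N (Suc j) \<omega>))\<^sup>2) \<and>
        expectation (\<lambda>\<omega>. (norm (N (Suc j) \<omega>))\<^sup>2) \<le> real (Suc j) * expectation (\<lambda>\<omega>. v (X \<omega>)) \<and>
        (\<forall>U. U \<in> borel_measurable (H 0) \<longrightarrow> integrable M (\<lambda>\<omega>. (norm (U \<omega>))\<^sup>2) \<longrightarrow>
          integrable M (\<lambda>\<omega>. U \<omega> \<bullet> N (Suc j) \<omega>) \<and> expectation (\<lambda>\<omega>. U \<omega> \<bullet> N (Suc j) \<omega>) = 0)"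
        using 1 2 3 4 by blast
    qed
  qed
  from all[of k] show "integrable M (\<lambda>\<omega>. (norm (N k \<omega>))\<^sup>2)"
    and "expectation (\<lambda>\<omega>. (norm (N k \<omega>))\<^sup>2) \<le> real k * expectation (\<lambda>\<omega>. v (X \<omega>))"
    and "U \<in> borel_measurable (H 0) \<Longrightarrow> integrable M (\<lambda>\<omega>. (norm (U \<omega>))\<^sup>2) \<Longrightarrow>
      integrable M (\<lambda>\<omega>. U \<omega> \<bullet> N k \<omega>) \<and> expectation (\<lambda>\<omega>. U \<omega> \<bullet> N k \<omega>) = 0"
    by auto
qed

end

text \<open>
  The generators are chosen as intersections of an event about the initial point with an event
  about the samples in \<open>K\<close>. They form a system closed under intersection, on which independence
  can be checked.
\<close>

definition history ::
  "'a measure \<Rightarrow> 'x measure \<Rightarrow> ('a \<Rightarrow> 'x) \<Rightarrow> 'z measure \<Rightarrow> ('j \<Rightarrow> 'a \<Rightarrow> 'z) \<Rightarrow> 'j set \<Rightarrow> 'a measure"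
  where "history M N x0 S s K = sigma (space M)
    {x0 -` A \<inter> (\<lambda>\<omega>. \<lambda>j\<in>K. s j \<omega>) -` B \<inter> space M |A B. A \<in> sets N \<and> B \<in> sets (PiM K (\<lambda>_. S))}"

lemma space_history[simp]: "space (history M N x0 S s K) = space M"
  by (auto simp: history_def space_measure_of_conv)

lemma sets_history: "sets (history M N x0 S s K) = sigma_sets (space M)
    {x0 -` A \<inter> (\<lambda>\<omega>. \<lambda>j\<in>K. s j \<omega>) -` B \<inter> space M |A B. A \<in> sets N \<and> B \<in> sets (PiM K (\<lambda>_. S))}"
  unfolding history_def by (rule sets_measure_of) auto

context
  fixes M :: "'a measure" and N :: "'x measure" and x0 :: "'a \<Rightarrow> 'x"
    and S :: "'z measure" and s :: "'j \<Rightarrow> 'a \<Rightarrow> 'z" and K :: "'j set"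
  assumes x0: "x0 \<in> measurable M N" and s: "\<And>j. j \<in> K \<Longrightarrow> s j \<in> measurable M S"
begin

lemma measurable_samples: "(\<lambda>\<omega>. \<lambda>j\<in>K. s j \<omega>) \<in> measurable M (PiM K (\<lambda>_. S))"
  using s by (intro measurable_restrict) auto

lemma history_generator_in_sets:
  assumes "A \<in> sets N" "B \<in> sets (PiM K (\<lambda>_. S))"
  shows "x0 -` A \<inter> (\<lambda>\<omega>. \<lambda>j\<in>K. s j \<omega>) -` B \<inter> space M \<in> sets M"
proof -
  have "(x0 -` A \<inter> space M) \<inter> ((\<lambda>\<omega>. \<lambda>j\<in>K. s j \<omega>) -` B \<inter> space M) \<in> sets M"
    using measurable_sets[OF x0 assms(1)] measurable_sets[OF measurable_samples assms(2)] by blast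
  then show ?thesis by (simp add: Int_ac)
qed

lemma subalgebra_history: "subalgebra M (history M N x0 S s K)"
  unfolding subalgebra_def sets_history
  using history_generator_in_sets by (auto intro!: sets.sigma_sets_subset)

lemma measurable_history_x0: "x0 \<in> measurable (history M N x0 S s K) N"
proof (rule measurableI)
  fix A assume A: "A \<in> sets N"
  have "x0 -` A \<inter> space M = x0 -` A \<inter> (\<lambda>\<omega>. \<lambda>j\<in>K. s j \<omega>) -` space (PiM K (\<lambda>_. S)) \<inter> space M"
    using measurable_space[OF measurable_samples] by auto
  then show "x0 -` A \<inter> space (history M N x0 S s K) \<in> sets (history M N x0 S s K)"
    using A by (auto simp: sets_history intro!: sigma_sets.Basic)
qed (use measurable_space[OF x0] in auto)

lemma measurable_history_samples:
  "(\<lambda>\<omega>. \<lambda>j\<in>K. s j \<omega>) \<in> measurable (history M N x0 S s K) (PiM K (\<lambda>_. S))"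
proof (rule measurableI)
  fix B assume B: "B \<in> sets (PiM K (\<lambda>_. S))"
  have "(\<lambda>\<omega>. \<lambda>j\<in>K. s j \<omega>) -` B \<inter> space M = x0 -` space N \<inter> (\<lambda>\<omega>. \<lambda>j\<in>K. s j \<omega>) -` B \<inter> space M"
    using measurable_space[OF x0] by auto
  then show "(\<lambda>\<omega>. \<lambda>j\<in>K. s j \<omega>) -` B \<inter> space (history M N x0 S s K) \<in> sets (history M N x0 S s K)"
    using B by (auto simp: sets_history intro!: sigma_sets.Basic)
qed (use measurable_space[OF measurable_samples] in auto)

lemma measurable_history_sample:
  assumes "j \<in> K"
  shows "s j \<in> measurable (history M N x0 S s K) S"
  using measurable_compose[OF measurable_history_samples measurable_component_singleton[OF assms]] assms
  by simp

end

text \<open>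
  The larger history makes all generators of the smaller one measurable; this is
  \<open>subalgebra_history\<close> applied with the larger history in the place of \<open>M\<close>.
\<close>

lemma subalgebra_history_mono:
  assumes "x0 \<in> measurable M N" "\<And>j. j \<in> K' \<Longrightarrow> s j \<in> measurable M S" "K \<subseteq> K'"
  shows "subalgebra (history M N x0 S s K') (history M N x0 S s K)"
proof -
  let ?H = "history M N x0 S s K'"
  have x: "x0 \<in> measurable ?H N" by (rule measurable_history_x0[OF assms(1,2)])
  have "s j \<in> measurable ?H S" if "j \<in> K" for j
    by (rule measurable_history_sample[OF assms(1,2)]) (use that assms(3) in auto)
  then have "subalgebra ?H (history ?H N x0 S s K)"
    by (intro subalgebra_history x)
  then show ?thesis by (simp add: subalgebra_def sets_history)
qed

text \<open>
  On a generator the probability factorises in two stages: the event about \<open>x0\<close> splits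
  off, as it is independent of the whole sample process, and then the events about \<open>K\<close>
  and about \<open>j\<close> separate, as the samples are independent. Closure under intersection
  extends this to the generated \<open>\<sigma>\<close>-algebra.
\<close>

lemma (in prob_space) fresh_history:
  assumes ind: "indep_vars (\<lambda>_. S) s I"
    and x0: "x0 \<in> measurable M N"
    and ind0: "indep_set (sets (vimage_algebra (space M) x0 N))
         (sets (vimage_algebra (space M) (\<lambda>\<omega>. \<lambda>j\<in>I. s j \<omega>) (PiM I (\<lambda>_. S))))"
    and K: "K \<subseteq> I" and j: "j \<in> I" "j \<notin> K"
  shows "fresh (history M N x0 S s K) S (s j)"
proof -
  let ?V = "vimage_algebra (space M) (\<lambda>\<omega>. \<lambda>j\<in>I. s j \<omega>) (PiM I (\<lambda>_. S))"
  let ?sK = "\<lambda>\<omega>. \<lambda>j\<in>K. s j \<omega>"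
  let ?E = "{x0 -` A \<inter> ?sK -` B \<inter> space M |A B. A \<in> sets N \<and> B \<in> sets (PiM K (\<lambda>_. S))}"
  have sm: "s i \<in> measurable M S" if "i \<in> I" for i
    using ind that by (auto simp: indep_vars_def)
  have sK: "?sK \<in> measurable M (PiM K (\<lambda>_. S))"
    using sm K by (intro measurable_restrict) auto
  have sV: "s i \<in> measurable ?V S" if "i \<in> I" for i
  proof -
    have "(\<lambda>\<omega>. \<lambda>j\<in>I. s j \<omega>) \<in> measurable ?V (PiM I (\<lambda>_. S))"
      using measurable_space[OF sm] by (intro measurable_vimage_algebra1) (auto simp: space_PiM)
    from measurable_compose[OF this measurable_component_singleton[OF that]] show ?thesis
      using that by simp
  qed
  have sKV: "?sK \<in> measurable ?V (PiM K (\<lambda>_. S))"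
    using sV K by (intro measurable_restrict) auto
  have "indep_set ?E {s j -` C \<inter> space M |C. C \<in> sets S}"
  proof (rule indep_setI)
    show "?E \<subseteq> events"
      using history_generator_in_sets[OF x0, of K s S] sm K by auto
    show "{s j -` C \<inter> space M |C. C \<in> sets S} \<subseteq> events"
      using sm[OF j(1)] by auto
    fix a c assume "a \<in> ?E" "c \<in> {s j -` C \<inter> space M |C. C \<in> sets S}"
    then obtain A B C where A: "A \<in> sets N" and B: "B \<in> sets (PiM K (\<lambda>_. S))" and C: "C \<in> sets S"
      and a: "a = (x0 -` A \<inter> space M) \<inter> (?sK -` B \<inter> space M)" and c: "c = s j -` C \<inter> space M"
      by auto
    let ?a = "x0 -` A \<inter> space M" and ?b = "?sK -` B \<inter> space M"
    have a0: "?a \<in> sets (vimage_algebra (space M) x0 N)" by (rule in_vimage_algebra[OF A])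
    have b0: "?b \<in> sets ?V" using measurable_sets[OF sKV B] by simp
    have c0: "c \<in> sets ?V" using measurable_sets[OF sV[OF j(1)] C] c by simp
    have "prob (a \<inter> c) = prob (?a \<inter> (?b \<inter> c))" unfolding a by (simp add: Int_assoc)
    also have "\<dots> = prob ?a * prob (?b \<inter> c)"
      using b0 c0 by (intro indep_setD[OF ind0 a0]) auto
    also have "prob (?b \<inter> c) = prob ?b * prob c"
    proof -
      have iv: "indep_var (PiM K (\<lambda>_. S)) ?sK (PiM {j} (\<lambda>_. S)) (\<lambda>\<omega>. \<lambda>i\<in>{j}. s i \<omega>)"
        using K j by (intro indep_var_restrict[OF ind]) auto
      let ?C = "(\<lambda>f. f j) -` C \<inter> space (PiM {j} (\<lambda>_. S))"
      have C': "?C \<in> sets (PiM {j} (\<lambda>_. S))"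
        using C by (intro measurable_sets[OF measurable_component_singleton]) auto
      have c': "(\<lambda>\<omega>. \<lambda>i\<in>{j}. s i \<omega>) -` ?C \<inter> space M = c"
        using measurable_space[OF sm[OF j(1)]] by (auto simp: c space_PiM)
      have "prob ((\<lambda>\<omega>. (?sK \<omega>, \<lambda>i\<in>{j}. s i \<omega>)) -` (B \<times> ?C) \<inter> space M) = prob ?b * prob c"
        using indep_varD[OF iv B C'] unfolding c' .
      also have "(\<lambda>\<omega>. (?sK \<omega>, \<lambda>i\<in>{j}. s i \<omega>)) -` (B \<times> ?C) \<inter> space M = ?b \<inter> c"
        unfolding c'[symmetric] by auto
      finally show ?thesis .
    qed
    also have "prob ?a * (prob ?b * prob c) = prob a * prob c"
      unfolding a using indep_setD[OF ind0 a0 b0] by simp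
    finally show "prob (a \<inter> c) = prob a * prob c" .
  qed
  then have "indep_set (sigma_sets (space M) ?E) (sigma_sets (space M) {s j -` C \<inter> space M |C. C \<in> sets S})"
  proof (rule indep_set_sigma_sets)
    show "Int_stable ?E"
    proof (rule Int_stableI, safe)
      fix A B A' B' assume "A \<in> sets N" "A' \<in> sets N" "B \<in> sets (PiM K (\<lambda>_. S))" "B' \<in> sets (PiM K (\<lambda>_. S))"
      then show "\<exists>A'' B''. x0 -` A \<inter> ?sK -` B \<inter> space M \<inter> (x0 -` A' \<inter> ?sK -` B' \<inter> space M)
          = x0 -` A'' \<inter> ?sK -` B'' \<inter> space M \<and> A'' \<in> sets N \<and> B'' \<in> sets (PiM K (\<lambda>_. S))"
        by (intro exI[of _ "A \<inter> A'"] exI[of _ "B \<inter> B'"]) auto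
    qed
    show "Int_stable {s j -` C \<inter> space M |C. C \<in> sets S}"
    proof (rule Int_stableI, safe)
      fix C C' assume "C \<in> sets S" "C' \<in> sets S"
      then show "\<exists>C''. s j -` C \<inter> space M \<inter> (s j -` C' \<inter> space M) = s j -` C'' \<inter> space M \<and> C'' \<in> sets S"
        by (intro exI[of _ "C \<inter> C'"]) auto
    qed
  qed
  moreover have "subalgebra M (history M N x0 S s K)"
    using sm K by (intro subalgebra_history x0) auto
  ultimately show ?thesis
    using sm[OF j(1)] by (simp add: fresh_def sets_history sets_vimage_algebra)
qed

section \<open>The expected energy decrease\<close>

lemma (in prob_space) affine_norm_second_moment:
  fixes U :: "'a \<Rightarrow> 'v::euclidean_space"
  assumes [measurable]: "U \<in> borel_measurable M" and U: "integrable M (\<lambda>\<omega>. (norm (U \<omega>))\<^sup>2)"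
    and s: "0 \<le> s" "s \<le> h" "0 \<le> t" "t \<le> h"
  shows "integrable M (\<lambda>\<omega>. (s + t * norm (U \<omega>))\<^sup>2)"
    and "expectation (\<lambda>\<omega>. (s + t * norm (U \<omega>))\<^sup>2) \<le> 2 * h\<^sup>2 * (1 + expectation (\<lambda>\<omega>. (norm (U \<omega>))\<^sup>2))"
proof -
  have le: "(s + t * norm (U \<omega>))\<^sup>2 \<le> 2 * h\<^sup>2 * (1 + (norm (U \<omega>))\<^sup>2)" for \<omega>
  proof -
    have "(s + t * norm (U \<omega>))\<^sup>2 \<le> (h + h * norm (U \<omega>))\<^sup>2"
      using s by (intro power_mono add_mono mult_right_mono) auto
    also have "\<dots> = h\<^sup>2 * (1 + norm (U \<omega>))\<^sup>2"
      by (simp add: power2_eq_square algebra_simps)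
    also have "\<dots> \<le> h\<^sup>2 * (2 * (1 + (norm (U \<omega>))\<^sup>2))"
      using sum_squares_bound[of 1 "norm (U \<omega>)"] by (intro mult_left_mono) (auto simp: power2_sum)
    finally show ?thesis by (simp add: algebra_simps)
  qed
  have i: "integrable M (\<lambda>\<omega>. 2 * h\<^sup>2 * (1 + (norm (U \<omega>))\<^sup>2))" using U by simp
  show int: "integrable M (\<lambda>\<omega>. (s + t * norm (U \<omega>))\<^sup>2)"
  proof (rule Bochner_Integration.integrable_bound[OF i])
    show "AE \<omega> in M. norm ((s + t * norm (U \<omega>))\<^sup>2) \<le> norm (2 * h\<^sup>2 * (1 + (norm (U \<omega>))\<^sup>2))"
    proof (intro always_eventually allI)
      fix \<omega>
      have "(s + t * norm (U \<omega>))\<^sup>2 \<ge> 0" by simp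
      with le[of \<omega>] show "norm ((s + t * norm (U \<omega>))\<^sup>2) \<le> norm (2 * h\<^sup>2 * (1 + (norm (U \<omega>))\<^sup>2))"
        unfolding real_norm_def by linarith
    qed
  qed measurable
  have "expectation (\<lambda>\<omega>. (s + t * norm (U \<omega>))\<^sup>2) \<le> expectation (\<lambda>\<omega>. 2 * h\<^sup>2 * (1 + (norm (U \<omega>))\<^sup>2))"
    by (rule integral_mono[OF int i le])
  also have "\<dots> = 2 * h\<^sup>2 * (1 + expectation (\<lambda>\<omega>. (norm (U \<omega>))\<^sup>2))"
    using U by (simp add: prob_space)
  finally show "expectation (\<lambda>\<omega>. (s + t * norm (U \<omega>))\<^sup>2)
      \<le> 2 * h\<^sup>2 * (1 + expectation (\<lambda>\<omega>. (norm (U \<omega>))\<^sup>2))" .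
qed

text \<open>
  Averaging divides the second moment of the sum, which is of order \<open>k\<close>, by \<open>k\<^sup>2\<close>. The point
  \<open>X\<close> must be known before the batch is drawn; this holds for both half steps, so
  the lemma serves for \<open>X\<close> with the samples \<open>\<xi>\<close> and for \<open>Y\<close> with the samples \<open>\<eta>\<close>.
\<close>

lemma (in prob_space) minibatch_mean_error:
  fixes f :: "'v::euclidean_space \<Rightarrow> 'z \<Rightarrow> 'v"
  assumes fr: "\<forall>i\<in>{1..k}. fresh (H (i - 1)) S (\<zeta> i)"
    and mono: "\<And>i. subalgebra (H (Suc i)) (H i)" and H0: "subalgebra M (H 0)"
    and meas: "\<forall>i\<in>{1..k}. \<zeta> i \<in> measurable (H i) S"
    and law: "\<forall>i\<in>{1..k}. distr M S (\<zeta> i) = P"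
    and f: "(\<lambda>(x, z). f x z) \<in> borel_measurable (borel \<Otimes>\<^sub>M S)" and T: "T \<in> borel_measurable borel"
    and mean: "\<And>x. (\<integral>z. f x z - T x \<partial>P) = 0"
    and var: "\<And>x. (\<integral>\<^sup>+z. ennreal ((norm (f x z - T x))\<^sup>2) \<partial>P) \<le> ennreal (c\<^sup>2 * (s + t * norm (x - p))\<^sup>2)"
    and X: "X \<in> borel_measurable (H 0)" and X2: "integrable M (\<lambda>\<omega>. (norm (X \<omega> - p))\<^sup>2)"
    and s: "0 \<le> s" "0 \<le> t" and k: "k \<ge> 1"
  defines "W \<equiv> \<lambda>\<omega>. (1 / real k) *\<^sub>R (\<Sum>i=1..k. f (X \<omega>) (\<zeta> i \<omega>)) - T (X \<omega>)"
  shows "integrable M (\<lambda>\<omega>. (norm (W \<omega>))\<^sup>2)"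
    and "expectation (\<lambda>\<omega>. (norm (W \<omega>))\<^sup>2)
      \<le> c\<^sup>2 * expectation (\<lambda>\<omega>. (s + t * norm (X \<omega> - p))\<^sup>2) / k"
    and "U \<in> borel_measurable (H 0) \<Longrightarrow> integrable M (\<lambda>\<omega>. (norm (U \<omega>))\<^sup>2) \<Longrightarrow>
      integrable M (\<lambda>\<omega>. W \<omega> \<bullet> U \<omega>) \<and> expectation (\<lambda>\<omega>. W \<omega> \<bullet> U \<omega>) = 0"
proof -
  let ?N = "\<lambda>\<omega>. \<Sum>i=1..k. f (X \<omega>) (\<zeta> i \<omega>) - T (X \<omega>)"
  have XM: "X \<in> borel_measurable M" by (rule measurable_from_subalg[OF H0 X])
  have G: "(\<lambda>(x, z). f x z - T x) \<in> borel_measurable (borel \<Otimes>\<^sub>M S)"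
    using borel_measurable_diff[OF f measurable_compose[OF measurable_fst T]]
    by (simp add: case_prod_beta)
  have vX: "integrable M (\<lambda>\<omega>. c\<^sup>2 * (s + t * norm (X \<omega> - p))\<^sup>2)"
    using affine_norm_second_moment(1)[of "\<lambda>\<omega>. X \<omega> - p" s "max s t" t] XM X2 s by simp
  have v0: "0 \<le> c\<^sup>2 * (s + t * norm (x - p))\<^sup>2" for x by simp
  note N = minibatch_moments[where k=k and H=H and S=S and \<zeta>=\<zeta> and P=P and X=X
      and G="\<lambda>x z. f x z - T x" and v="\<lambda>x. c\<^sup>2 * (s + t * norm (x - p))\<^sup>2",
      OF fr mono meas law G mean var X v0 vX]
  have W: "W \<omega> = (1 / real k) *\<^sub>R ?N \<omega>" for \<omega>
    using k by (simp add: W_def sum_subtractf scaleR_diff_right sum_constant_scaleR)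
  have W2: "(norm (W \<omega>))\<^sup>2 = (1 / (real k)\<^sup>2) * (norm (?N \<omega>))\<^sup>2" for \<omega>
    unfolding W by (simp add: power_mult_distrib power_divide)
  show "integrable M (\<lambda>\<omega>. (norm (W \<omega>))\<^sup>2)"
    unfolding W2 using N(1) by simp
  have "expectation (\<lambda>\<omega>. (norm (W \<omega>))\<^sup>2) = (1 / (real k)\<^sup>2) * expectation (\<lambda>\<omega>. (norm (?N \<omega>))\<^sup>2)"
    unfolding W2 by simp
  also have "\<dots> \<le> (1 / (real k)\<^sup>2) * (real k * (c\<^sup>2 * expectation (\<lambda>\<omega>. (s + t * norm (X \<omega> - p))\<^sup>2)))"
    using N(2) by (intro mult_left_mono) simp_all
  also have "\<dots> = c\<^sup>2 * expectation (\<lambda>\<omega>. (s + t * norm (X \<omega> - p))\<^sup>2) / k"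
    using k by (simp add: power2_eq_square)
  finally show "expectation (\<lambda>\<omega>. (norm (W \<omega>))\<^sup>2)
      \<le> c\<^sup>2 * expectation (\<lambda>\<omega>. (s + t * norm (X \<omega> - p))\<^sup>2) / k" .
  assume U: "U \<in> borel_measurable (H 0)" "integrable M (\<lambda>\<omega>. (norm (U \<omega>))\<^sup>2)"
  have WU: "W \<omega> \<bullet> U \<omega> = (1 / real k) * (U \<omega> \<bullet> ?N \<omega>)" for \<omega>
    unfolding W by (simp add: inner_commute)
  show "integrable M (\<lambda>\<omega>. W \<omega> \<bullet> U \<omega>) \<and> expectation (\<lambda>\<omega>. W \<omega> \<bullet> U \<omega>) = 0"
    unfolding WU using N(3)[OF U] by simp
qed

text \<open>
  The expectation of the energy inequality for a single step. The \<open>\<sigma>\<close>-algebra \<open>H i\<close> contains the past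
  and the first \<open>i\<close> samples \<open>\<xi>\<close>; \<open>H' i\<close> contains the past and the first \<open>i\<close> samples \<open>\<eta>\<close>, and \<open>Y\<close> is
  determined by \<open>H' 0\<close>. Hence \<open>Z \<bullet> (Y - p)\<close> has mean zero. The variance at \<open>Y\<close> is first bounded in
  terms of the distance of \<open>Y\<close>, and then, by \<open>fbf_half_step_growth\<close>, in terms of the distance of \<open>X\<close> and
  the first error.
\<close>

lemma (in prob_space) sfbf_expected_energy:
  fixes f :: "'v::euclidean_space \<Rightarrow> 'z \<Rightarrow> 'v"
  assumes C: "closed C" "convex C"
    and p: "p \<in> vi_solutions C T" and pm: "pseudo_monotone T"
    and L: "L > 0" "L-lipschitz_on UNIV T" and \<alpha>: "\<alpha> > 0" "2 * \<alpha>\<^sup>2 * L\<^sup>2 < 1"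
    and f: "(\<lambda>(x, z). f x z) \<in> borel_measurable (borel \<Otimes>\<^sub>M S)"
    and mean: "\<And>x. (\<integral>z. f x z - T x \<partial>P) = 0"
    and var: "\<And>x. (\<integral>\<^sup>+z. ennreal ((norm (f x z - T x))\<^sup>2) \<partial>P) \<le> ennreal (C2\<^sup>2 * (\<sigma> + \<sigma>0 * norm (x - p))\<^sup>2)"
    and \<sigma>: "0 \<le> \<sigma>" "\<sigma> \<le> \<sigma>h" "0 \<le> \<sigma>0" "\<sigma>0 \<le> \<sigma>h" and C2: "C2 > 0" and c1: "c1 \<ge> 1"
    and k: "k = m (n + 1)" "k \<ge> 1"
    and kap: "kappa \<alpha> L \<sigma>0 C2 m n \<le> \<alpha>\<^sup>2 * C2\<^sup>2 * c1 * (1 + \<alpha>\<^sup>2 * \<sigma>0\<^sup>2 * C2\<^sup>2 / real (m (n + 1)))"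
    and a: "a = \<sigma>h\<^sup>2 * \<alpha>\<^sup>2 * C2\<^sup>2 * c1"
    and fr: "\<forall>i\<in>{1..k}. fresh (H (i - 1)) S (\<xi> i)"
    and mono: "\<And>i. subalgebra (H (Suc i)) (H i)" and H0: "subalgebra M (H 0)"
    and meas: "\<forall>i\<in>{1..k}. \<xi> i \<in> measurable (H i) S"
    and law: "\<forall>i\<in>{1..k}. distr M S (\<xi> i) = P"
    and fr': "\<forall>i\<in>{1..k}. fresh (H' (i - 1)) S (\<eta> i)"
    and mono': "\<And>i. subalgebra (H' (Suc i)) (H' i)" and H0': "subalgebra M (H' 0)"
    and meas': "\<forall>i\<in>{1..k}. \<eta> i \<in> measurable (H' i) S"
    and law': "\<forall>i\<in>{1..k}. distr M S (\<eta> i) = P"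
    and XH: "X \<in> borel_measurable (H 0)" and YH: "Y \<in> borel_measurable (H' 0)"
    and X'M: "X' \<in> borel_measurable M"
    and A: "\<And>\<omega>. A \<omega> = (1 / real k) *\<^sub>R (\<Sum>i=1..k. f (X \<omega>) (\<xi> i \<omega>))"
    and Y: "\<And>\<omega>. Y \<omega> = closest_point C (X \<omega> - \<alpha> *\<^sub>R A \<omega>)"
    and B: "\<And>\<omega>. B \<omega> = (1 / real k) *\<^sub>R (\<Sum>i=1..k. f (Y \<omega>) (\<eta> i \<omega>))"
    and X': "\<And>\<omega>. X' \<omega> = Y \<omega> + \<alpha> *\<^sub>R (A \<omega> - B \<omega>)"
    and fin: "(\<integral>\<^sup>+\<omega>. ennreal ((norm (X \<omega> - p))\<^sup>2) \<partial>M) < \<infinity>"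
  shows "(\<integral>\<^sup>+\<omega>. ennreal ((norm (X' \<omega> - p))\<^sup>2) \<partial>M)
      + ennreal ((1 - 2 * \<alpha>\<^sup>2 * L\<^sup>2) / 2) * (\<integral>\<^sup>+\<omega>. ennreal ((residual C T \<alpha> (X \<omega>))\<^sup>2) \<partial>M)
    \<le> (\<integral>\<^sup>+\<omega>. ennreal ((norm (X \<omega> - p))\<^sup>2) \<partial>M)
      + ennreal (a / k + (a / k)\<^sup>2) * (1 + (\<integral>\<^sup>+\<omega>. ennreal ((norm (X \<omega> - p))\<^sup>2) \<partial>M))"
proof -
  define \<rho> where "\<rho> = 1 - 2 * \<alpha>\<^sup>2 * L\<^sup>2"
  have \<rho>: "\<rho> > 0" using \<alpha> by (simp add: \<rho>_def)
  have ne: "C \<noteq> {}" using p by (auto simp: vi_solutions_def)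
  have Tc: "continuous_on UNIV T" by (rule lipschitz_on_continuous_on[OF L(2)])
  then have TM[measurable]: "T \<in> borel_measurable borel" by (rule borel_measurable_continuous_onI)
  have XM[measurable]: "X \<in> borel_measurable M" by (rule measurable_from_subalg[OF H0 XH])
  have YM[measurable]: "Y \<in> borel_measurable M" by (rule measurable_from_subalg[OF H0' YH])
  note [measurable] = X'M
  define W where "W \<omega> = (1 / real k) *\<^sub>R (\<Sum>i=1..k. f (X \<omega>) (\<xi> i \<omega>)) - T (X \<omega>)" for \<omega>
  define Z where "Z \<omega> = (1 / real k) *\<^sub>R (\<Sum>i=1..k. f (Y \<omega>) (\<eta> i \<omega>)) - T (Y \<omega>)" for \<omega>
  have AW: "A \<omega> = T (X \<omega>) + W \<omega>" and BZ: "B \<omega> = T (Y \<omega>) + Z \<omega>" for \<omega>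
    by (simp_all add: W_def Z_def A B)
  define d where "d = expectation (\<lambda>\<omega>. (norm (X \<omega> - p))\<^sup>2)"
  have d: "d \<ge> 0" by (simp add: d_def)
  have X2: "integrable M (\<lambda>\<omega>. (norm (X \<omega> - p))\<^sup>2)"
    using fin by (intro integrableI_bounded) auto
  have nnd: "(\<integral>\<^sup>+\<omega>. ennreal ((norm (X \<omega> - p))\<^sup>2) \<partial>M) = ennreal d"
    unfolding d_def by (rule nn_integral_eq_integral[OF X2]) simp
  note mW = minibatch_mean_error[where k=k and H=H and \<zeta>=\<xi>, OF fr mono H0 meas law f TM mean var XH X2 \<sigma>(1,3) k(2),
      folded W_def]
  define EW where "EW = expectation (\<lambda>\<omega>. (norm (W \<omega>))\<^sup>2)"
  have EW: "EW \<le> C2\<^sup>2 * (2 * \<sigma>h\<^sup>2 * (1 + d)) / k"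
  proof -
    have "EW \<le> C2\<^sup>2 * expectation (\<lambda>\<omega>. (\<sigma> + \<sigma>0 * norm (X \<omega> - p))\<^sup>2) / k"
      unfolding EW_def by (rule mW(2))
    also have "\<dots> \<le> C2\<^sup>2 * (2 * \<sigma>h\<^sup>2 * (1 + d)) / k"
      unfolding d_def using X2 \<sigma>
      by (intro divide_right_mono mult_left_mono affine_norm_second_moment(2)) auto
    finally show ?thesis .
  qed
  define l where "l = 1 + \<alpha> * L"
  have l: "l \<ge> 1" using \<alpha> L by (simp add: l_def)
  have sq2: "(x + y)\<^sup>2 \<le> 2 * x\<^sup>2 + 2 * y\<^sup>2" for x y :: real
    using sum_squares_bound[of x y] by (simp add: power2_sum)
  have growth: "norm (Y \<omega> - p) \<le> l * norm (X \<omega> - p) + \<alpha> * norm (W \<omega>)" for \<omega>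
    unfolding l_def using \<alpha> by (intro fbf_half_step_growth[OF C p L(2)]) (auto simp: Y AW)
  have Y2: "integrable M (\<lambda>\<omega>. (norm (Y \<omega> - p))\<^sup>2)"
  proof (rule Bochner_Integration.integrable_bound)
    show "integrable M (\<lambda>\<omega>. 2 * (l * norm (X \<omega> - p))\<^sup>2 + 2 * (\<alpha> * norm (W \<omega>))\<^sup>2)"
      using X2 mW(1) by (simp add: power_mult_distrib)
    show "AE \<omega> in M. norm ((norm (Y \<omega> - p))\<^sup>2) \<le> norm (2 * (l * norm (X \<omega> - p))\<^sup>2 + 2 * (\<alpha> * norm (W \<omega>))\<^sup>2)"
    proof (intro always_eventually allI)
      fix \<omega>
      have "(norm (Y \<omega> - p))\<^sup>2 \<le> (l * norm (X \<omega> - p) + \<alpha> * norm (W \<omega>))\<^sup>2"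
        by (intro power_mono growth) simp
      also note sq2
      finally show "norm ((norm (Y \<omega> - p))\<^sup>2) \<le> norm (2 * (l * norm (X \<omega> - p))\<^sup>2 + 2 * (\<alpha> * norm (W \<omega>))\<^sup>2)"
        by simp
    qed
  qed measurable
  note mZ = minibatch_mean_error[where k=k and H=H' and \<zeta>=\<eta>, OF fr' mono' H0' meas' law' f TM mean var YH Y2 \<sigma>(1,3) k(2),
      folded Z_def]
  have ZY: "integrable M (\<lambda>\<omega>. Z \<omega> \<bullet> (Y \<omega> - p))" "expectation (\<lambda>\<omega>. Z \<omega> \<bullet> (Y \<omega> - p)) = 0"
    using mZ(3)[of "\<lambda>\<omega>. Y \<omega> - p"] YH Y2 by auto
  define EZ where "EZ = expectation (\<lambda>\<omega>. (norm (Z \<omega>))\<^sup>2)"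
  have EZ: "EZ \<le> C2\<^sup>2 * (4 * \<sigma>h\<^sup>2 * (1 + \<alpha> * L)\<^sup>2 * (1 + d) + 2 * \<alpha>\<^sup>2 * \<sigma>0\<^sup>2 * EW) / k"
  proof -
    have "EZ \<le> C2\<^sup>2 * expectation (\<lambda>\<omega>. (\<sigma> + \<sigma>0 * norm (Y \<omega> - p))\<^sup>2) / k"
      unfolding EZ_def by (rule mZ(2))
    also have "expectation (\<lambda>\<omega>. (\<sigma> + \<sigma>0 * norm (Y \<omega> - p))\<^sup>2)
        \<le> expectation (\<lambda>\<omega>. 2 * (\<sigma> + (\<sigma>0 * l) * norm (X \<omega> - p))\<^sup>2 + 2 * (\<alpha> * \<sigma>0)\<^sup>2 * (norm (W \<omega>))\<^sup>2)"
    proof (rule integral_mono)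
      show "integrable M (\<lambda>\<omega>. (\<sigma> + \<sigma>0 * norm (Y \<omega> - p))\<^sup>2)"
        using affine_norm_second_moment(1)[of "\<lambda>\<omega>. Y \<omega> - p" \<sigma> \<sigma>h \<sigma>0] Y2 \<sigma> by simp
      show "integrable M (\<lambda>\<omega>. 2 * (\<sigma> + (\<sigma>0 * l) * norm (X \<omega> - p))\<^sup>2 + 2 * (\<alpha> * \<sigma>0)\<^sup>2 * (norm (W \<omega>))\<^sup>2)"
        using affine_norm_second_moment(1)[of "\<lambda>\<omega>. X \<omega> - p" \<sigma> "max \<sigma> (\<sigma>0 * l)" "\<sigma>0 * l"] X2 \<sigma> l mW(1)
        by simp
      fix \<omega>
      have "\<sigma>0 * norm (Y \<omega> - p) \<le> \<sigma>0 * (l * norm (X \<omega> - p) + \<alpha> * norm (W \<omega>))"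
        by (intro mult_left_mono growth \<sigma>)
      then have "(\<sigma> + \<sigma>0 * norm (Y \<omega> - p))\<^sup>2
          \<le> ((\<sigma> + (\<sigma>0 * l) * norm (X \<omega> - p)) + (\<alpha> * \<sigma>0) * norm (W \<omega>))\<^sup>2"
        using \<sigma> by (intro power_mono) (auto simp: algebra_simps)
      also note sq2
      finally show "(\<sigma> + \<sigma>0 * norm (Y \<omega> - p))\<^sup>2
          \<le> 2 * (\<sigma> + (\<sigma>0 * l) * norm (X \<omega> - p))\<^sup>2 + 2 * (\<alpha> * \<sigma>0)\<^sup>2 * (norm (W \<omega>))\<^sup>2"
        by (simp add: power_mult_distrib)
    qed
    also have "\<dots> = 2 * expectation (\<lambda>\<omega>. (\<sigma> + (\<sigma>0 * l) * norm (X \<omega> - p))\<^sup>2) + 2 * (\<alpha> * \<sigma>0)\<^sup>2 * EW"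
      using affine_norm_second_moment(1)[of "\<lambda>\<omega>. X \<omega> - p" \<sigma> "max \<sigma> (\<sigma>0 * l)" "\<sigma>0 * l"] X2 \<sigma> l mW(1)
      by (simp add: EW_def)
    also have "\<dots> \<le> 2 * (2 * (\<sigma>h * l)\<^sup>2 * (1 + d)) + 2 * (\<alpha> * \<sigma>0)\<^sup>2 * EW"
    proof -
      have "\<sigma> \<le> \<sigma>h * l" using mult_mono[of \<sigma> \<sigma>h 1 l] \<sigma> l by simp
      then show ?thesis
        unfolding d_def using X2 \<sigma> l
        by (intro add_right_mono mult_left_mono affine_norm_second_moment(2)) (auto intro: mult_right_mono)
    qed
    also have "\<dots> = 4 * \<sigma>h\<^sup>2 * (1 + \<alpha> * L)\<^sup>2 * (1 + d) + 2 * \<alpha>\<^sup>2 * \<sigma>0\<^sup>2 * EW"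
      by (simp add: l_def power_mult_distrib)
    finally show ?thesis by (simp add: divide_right_mono mult_left_mono)
  qed
  have noise: "(4 + \<rho>) * \<alpha>\<^sup>2 * EW + 4 * \<alpha>\<^sup>2 * EZ \<le> (a / k + (a / k)\<^sup>2) * (1 + d)"
    unfolding \<rho>_def
    by (rule noise_coefficient_bound[OF kap k C2 c1 \<alpha>(1) L(1) \<alpha>(2) \<sigma>(3,4) d EW EZ a])
  have rm[measurable]: "(\<lambda>\<omega>. residual C T \<alpha> (X \<omega>)) \<in> borel_measurable M"
  proof -
    have "continuous_on UNIV (residual C T \<alpha>)"
      unfolding residual_def[abs_def]
      by (intro continuous_intros continuous_on_compose2[OF continuous_on_closest_point[OF C(2,1) ne, of UNIV]] Tc) auto
    then show ?thesis
      by (intro measurable_compose[OF XM borel_measurable_continuous_onI])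
  qed
  let ?g = "\<lambda>\<omega>. (norm (X \<omega> - p))\<^sup>2 - 2 * \<alpha> * (Z \<omega> \<bullet> (Y \<omega> - p))
      + (4 + \<rho>) * \<alpha>\<^sup>2 * (norm (W \<omega>))\<^sup>2 + 4 * \<alpha>\<^sup>2 * (norm (Z \<omega>))\<^sup>2"
  have energy: "(norm (X' \<omega> - p))\<^sup>2 + \<rho> / 2 * (residual C T \<alpha> (X \<omega>))\<^sup>2 \<le> ?g \<omega>" for \<omega>
    unfolding \<rho>_def
    by (rule fbf_step_energy[OF C p pm L(2) \<alpha>]) (simp_all add: Y X' AW BZ)
  have g: "integrable M ?g" using X2 ZY(1) mW(1) mZ(1) by simp
  have "(\<integral>\<^sup>+\<omega>. ennreal ((norm (X' \<omega> - p))\<^sup>2) \<partial>M)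
      + ennreal (\<rho> / 2) * (\<integral>\<^sup>+\<omega>. ennreal ((residual C T \<alpha> (X \<omega>))\<^sup>2) \<partial>M)
    = (\<integral>\<^sup>+\<omega>. ennreal ((norm (X' \<omega> - p))\<^sup>2) + ennreal (\<rho> / 2) * ennreal ((residual C T \<alpha> (X \<omega>))\<^sup>2) \<partial>M)"
    by (simp add: nn_integral_add nn_integral_cmult)
  also have "\<dots> \<le> (\<integral>\<^sup>+\<omega>. ennreal (?g \<omega>) \<partial>M)"
    using energy \<rho> by (intro nn_integral_mono) (simp add: ennreal_mult[symmetric] ennreal_plus[symmetric] ennreal_leI del: ennreal_plus)
  also have "\<dots> = ennreal (expectation ?g)"
  proof (rule nn_integral_eq_integral[OF g], intro always_eventually allI)
    fix \<omega>
    have "0 \<le> (norm (X' \<omega> - p))\<^sup>2 + \<rho> / 2 * (residual C T \<alpha> (X \<omega>))\<^sup>2" using \<rho> by simp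
    also note energy
    finally show "0 \<le> ?g \<omega>" .
  qed
  also have "expectation ?g = d + (4 + \<rho>) * \<alpha>\<^sup>2 * EW + 4 * \<alpha>\<^sup>2 * EZ"
    using X2 ZY mW(1) mZ(1) by (simp add: d_def EW_def EZ_def)
  also have "ennreal (d + (4 + \<rho>) * \<alpha>\<^sup>2 * EW + 4 * \<alpha>\<^sup>2 * EZ) \<le> ennreal (d + (a / k + (a / k)\<^sup>2) * (1 + d))"
    using noise by (intro ennreal_leI) simp
  also have "\<dots> = ennreal d + ennreal (a / k + (a / k)\<^sup>2) * (1 + ennreal d)"
  proof -
    have "a \<ge> 0" using c1 by (simp add: a)
    then show ?thesis using d
      by (simp add: ennreal_mult[symmetric] ennreal_plus[symmetric] ennreal_1[symmetric] del: ennreal_plus ennreal_1)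
  qed
  finally show ?thesis by (simp only: nnd \<rho>_def)
qed

section \<open>The complexity bound\<close>

text \<open>
  It remains to realise the iterates by measurable maps and to exhibit the filtration. The
  modified kernel \<open>f\<close> generates iterates \<open>X'\<close> that are adapted to \<open>history\<close> and agree with \<open>X\<close>
  almost surely, so \<open>D\<close> and \<open>R\<close> are the same for both; the expected energy decrease for \<open>X'\<close> is
  the recursion required by \<open>hitting_index_bound\<close>.
\<close>

theorem theorem5p3:
  fixes M :: "'a measure"
    and S :: "'z measure"
    and \<xi> :: "'a \<Rightarrow> 'z"
    and F :: "real ^ 'd \<Rightarrow> 'z \<Rightarrow> real ^ 'd"
    and T :: "real ^ 'd \<Rightarrow> real ^ 'd"
    and \<X> \<X>s :: "(real ^ 'd) set"
    and L \<alpha> p \<sigma>0 C2 c1 \<rho> \<sigma>hat a \<phi> :: real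
    and \<sigma> :: "real ^ 'd \<Rightarrow> real"
    and m :: "nat \<Rightarrow> nat"
    and J :: "(nat \<times> nat) set"
    and \<xi>s \<eta>s :: "nat \<Rightarrow> nat \<Rightarrow> 'a \<Rightarrow> 'z"
    and samples :: "(nat \<times> nat) + (nat \<times> nat) \<Rightarrow> 'a \<Rightarrow> 'z"
    and X Y A B :: "nat \<Rightarrow> 'a \<Rightarrow> real ^ 'd"
    and xs :: "real ^ 'd"
    and D R :: "nat \<Rightarrow> ennreal"
  assumes "prob_space M"
    and "\<xi> \<in> measurable M S"
    and "\<forall>x. integrable M (\<lambda>\<omega>. F x (\<xi> \<omega>))"
    and T_def: "\<forall>x. T x = (\<integral>\<omega>. F x (\<xi> \<omega>) \<partial>M)"
    and \<X>s_def: "\<X>s = vi_solutions \<X> T"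
    and A1: "\<X>s \<noteq> {}"
    and A2: "\<X> \<noteq> {}" "closed \<X>" "convex \<X>"
      "AE z in distr M S \<xi>. continuous_on UNIV (\<lambda>x. F x z)"
      "\<forall>x. F x \<in> borel_measurable S"
    and A3: "L > 0" "L-lipschitz_on UNIV T"
    and A4: "pseudo_monotone T"
    and A5: "0 < \<alpha>" "\<alpha> < 1 / (sqrt 2 * L)"
    and A6: "\<forall>n\<ge>1. m n \<ge> 1" "summable (\<lambda>n. 1 / real (m (n + 1)))"
    and A7: "p \<ge> 2" "\<sigma>0 \<ge> 0" "\<forall>s\<in>\<X>s. \<sigma> s \<ge> 0"
      "\<sigma> \<in> borel_measurable (restrict_space borel \<X>s)" "locally_bounded_on \<X>s \<sigma>"
      "\<forall>x. \<forall>s\<in>\<X>s. enn_root p (\<integral>\<^sup>+\<omega>. ennreal (norm (F x (\<xi> \<omega>) - T x) powr p) \<partial>M)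
                      \<le> ennreal (\<sigma> s + \<sigma>0 * norm (x - s))"
    and J_def: "J = (SIGMA n:{1..}. {1..m n})"
    and samples_def:
      "samples = case_sum (\<lambda>(n, i). \<xi>s n i) (\<lambda>(n, i). \<eta>s n i)"
    and iid: "prob_space.indep_vars M (\<lambda>_. S) samples (J <+> J)"
      "\<forall>j\<in>J <+> J. distr M S (samples j) = distr M S \<xi>"
    and X0: "X 0 \<in> borel_measurable M"
      "prob_space.indep_set M
         (sets (vimage_algebra (space M) (X 0) borel))
         (sets (vimage_algebra (space M) (\<lambda>\<omega>. \<lambda>j\<in>J <+> J. samples j \<omega>) (PiM (J <+> J) (\<lambda>_. S))))"
    and SFBF:
      "\<forall>n. \<forall>\<omega>\<in>space M.
         A (n + 1) \<omega> = (1 / real (m (n + 1))) *\<^sub>R (\<Sum>i=1..m (n + 1). F (X n \<omega>) (\<xi>s (n + 1) i \<omega>))"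
      "\<forall>n. \<forall>\<omega>\<in>space M. Y n \<omega> = closest_point \<X> (X n \<omega> - \<alpha> *\<^sub>R A (n + 1) \<omega>)"
      "\<forall>n. \<forall>\<omega>\<in>space M.
         B (n + 1) \<omega> = (1 / real (m (n + 1))) *\<^sub>R (\<Sum>i=1..m (n + 1). F (Y n \<omega>) (\<eta>s (n + 1) i \<omega>))"
      "\<forall>n. \<forall>\<omega>\<in>space M. X (n + 1) \<omega> = Y n \<omega> + \<alpha> *\<^sub>R (A (n + 1) \<omega> - B (n + 1) \<omega>)"
    and C2: "bdg_constant TYPE('a) TYPE(real ^ 'd) 2 C2"
    and c1: "c1 > 1"
      "\<forall>n. kappa \<alpha> L \<sigma>0 C2 m n
            \<le> \<alpha>\<^sup>2 * C2\<^sup>2 * c1 * (1 + \<alpha>\<^sup>2 * \<sigma>0\<^sup>2 * C2\<^sup>2 / real (m (n + 1)))"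
    and xs: "xs \<in> \<X>s"
    and \<sigma>hat_def: "\<sigma>hat = max (\<sigma> xs) \<sigma>0"
    and a_def: "a = \<sigma>hat\<^sup>2 * \<alpha>\<^sup>2 * C2\<^sup>2 * c1"
    and \<phi>: "0 < \<phi>" "\<phi> < (sqrt 5 - 1) / 2"
    and \<rho>_def: "\<rho> = 1 - 2 * \<alpha>\<^sup>2 * L\<^sup>2"
    and D_def: "\<forall>n. D n = (\<integral>\<^sup>+\<omega>. ennreal ((norm (X n \<omega> - xs))\<^sup>2) \<partial>M)"
    and R_def: "\<forall>n. R n = (\<integral>\<^sup>+\<omega>. ennreal ((residual \<X> T \<alpha> (X n \<omega>))\<^sup>2) \<partial>M)"
  shows "\<forall>\<epsilon>>0.
      (D 0 < \<infinity> \<longrightarrow> hitting_index R \<epsilon> < \<infinity>) \<and>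
      (\<forall>N. hitting_index R \<epsilon> = enat N \<longrightarrow>
         N = 0 \<or>
         (R N \<le> ennreal \<epsilon> \<and> ennreal \<epsilon> < Lambda_sup \<rho> a m D \<phi> / of_nat N))"
proof (intro allI impI)
  interpret prob_space M by fact
  fix \<epsilon> :: real assume \<epsilon>: "\<epsilon> > 0"
  let ?I = "J <+> J" and ?P = "distr M S \<xi>"
  have \<xi>M: "\<xi> \<in> measurable M S" and Fint: "\<And>x. integrable M (\<lambda>\<omega>. F x (\<xi> \<omega>))"
    using assms(2,3) by auto
  have Fm: "F x \<in> borel_measurable S" for x using A2(5) by simp
  have sm: "samples j \<in> measurable M S" if "j \<in> ?I" for j
    using iid(1) that by (auto simp: indep_vars_def)
  have mpos: "m (n + 1) \<ge> 1" for n using A6(1) by simp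
  have IJ: "Inl (n + 1, i) \<in> ?I" "Inr (n + 1, i) \<in> ?I" if "i \<in> {1..m (n + 1)}" for n i
    using that by (auto simp: J_def)
  have smp: "samples (Inl (l, i)) = \<xi>s l i" "samples (Inr (l, i)) = \<eta>s l i" for l i
    by (simp_all add: samples_def)
  have C2pos: "C2 > 0" using C2 by (simp add: bdg_constant_def)
  have sol: "xs \<in> vi_solutions \<X> T" using xs \<X>s_def by simp
  have \<rho>1: "2 * \<alpha>\<^sup>2 * L\<^sup>2 < 1"
  proof -
    have "\<alpha> * (sqrt 2 * L) < 1" using A5 A3(1) by (simp add: field_simps)
    then have "(\<alpha> * (sqrt 2 * L))\<^sup>2 < 1"
      using A5(1) A3(1) by (intro power_less_one_iff[THEN iffD2]) auto
    then show ?thesis by (simp add: power_mult_distrib mult_ac)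
  qed
  have \<phi>1: "\<phi> + \<phi>\<^sup>2 < 1"
  proof -
    have "(2 * \<phi> + 1)\<^sup>2 < (sqrt 5)\<^sup>2" using \<phi> by (intro power_strict_mono) auto
    then show ?thesis by (simp add: power2_eq_square algebra_simps)
  qed
  have \<sigma>xs: "\<sigma> xs \<ge> 0" using A7(3) xs by simp
  have Tc: "continuous_on UNIV T" by (rule lipschitz_on_continuous_on[OF A3(2)])
  have Tm: "T \<in> borel_measurable borel" by (rule borel_measurable_continuous_onI[OF Tc])

  obtain N where N: "{z \<in> space ?P. \<not> continuous_on UNIV (\<lambda>x. F x z)} \<subseteq> N" "emeasure ?P N = 0" "N \<in> sets ?P"
    by (rule AE_E[OF A2(4)])
  have NS: "N \<in> sets S" using N(3) by simp
  have NP: "AE z in ?P. z \<notin> N" using N by (intro AE_not_in) auto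
  \<comment> \<open>\<open>f\<close> agrees with \<open>F\<close> off the null set and is continuous in \<open>x\<close> for every sample.\<close>
  define f where "f x z = (if z \<in> N then 0 else F x z)" for x z
  have fm1: "f x \<in> borel_measurable S" for x
    unfolding f_def[abs_def] using NS Fm by (intro measurable_If) auto
  have fm: "(\<lambda>(x, z). f x z) \<in> borel_measurable (borel \<Otimes>\<^sub>M S)"
  proof (rule borel_measurable_caratheodory[OF _ fm1])
    fix z assume "z \<in> space S"
    then show "continuous_on UNIV (\<lambda>x. f x z)" using N(1) by (cases "z \<in> N") (auto simp: f_def)
  qed
  have fF: "AE z in ?P. f x z = F x z" for x
    using NP by eventually_elim (simp add: f_def)
  have mean: "(\<integral>z. f x z - T x \<partial>?P) = 0" for x
  proof -
    have "(\<integral>z. f x z - T x \<partial>?P) = (\<integral>z. F x z - T x \<partial>?P)"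
    proof (rule integral_cong_AE)
      show "AE z in ?P. f x z - T x = F x z - T x" using fF[of x] by eventually_elim simp
    qed (use fm1 Fm in simp_all)
    also have "\<dots> = (\<integral>\<omega>. F x (\<xi> \<omega>) - T x \<partial>M)"
      using Fm by (intro integral_distr[OF \<xi>M]) auto
    also have "\<dots> = 0" using Fint T_def by (simp add: prob_space)
    finally show ?thesis .
  qed
  have var: "(\<integral>\<^sup>+z. ennreal ((norm (f x z - T x))\<^sup>2) \<partial>?P) \<le> ennreal (C2\<^sup>2 * (\<sigma> xs + \<sigma>0 * norm (x - xs))\<^sup>2)" for x
  proof -
    have "(\<integral>\<^sup>+z. ennreal ((norm (f x z - T x))\<^sup>2) \<partial>?P) = (\<integral>\<^sup>+z. ennreal ((norm (F x z - T x))\<^sup>2) \<partial>?P)"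
    proof (rule nn_integral_cong_AE)
      show "AE z in ?P. ennreal ((norm (f x z - T x))\<^sup>2) = ennreal ((norm (F x z - T x))\<^sup>2)"
        using fF[of x] by eventually_elim simp
    qed
    also have "\<dots> = (\<integral>\<^sup>+\<omega>. ennreal ((norm (F x (\<xi> \<omega>) - T x))\<^sup>2) \<partial>M)"
      using Fm by (intro nn_integral_distr[OF \<xi>M]) auto
    also have "\<dots> \<le> ennreal (C2\<^sup>2 * (\<sigma> xs + \<sigma>0 * norm (x - xs))\<^sup>2)"
    proof (rule second_moment_le_bdg[OF C2])
      show "integrable M (\<lambda>\<omega>. F x (\<xi> \<omega>) - T x)" "expectation (\<lambda>\<omega>. F x (\<xi> \<omega>) - T x) = 0"
        using Fint T_def by (simp_all add: prob_space)
      show "(\<integral>\<^sup>+\<omega>. ennreal ((norm (F x (\<xi> \<omega>) - T x))\<^sup>2) \<partial>M) \<le> ennreal ((\<sigma> xs + \<sigma>0 * norm (x - xs))\<^sup>2)"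
      proof (rule second_moment_le_moment[OF _ _ A7(1)])
        show "enn_root p (\<integral>\<^sup>+\<omega>. ennreal (norm (F x (\<xi> \<omega>) - T x) powr p) \<partial>M)
            \<le> ennreal (\<sigma> xs + \<sigma>0 * norm (x - xs))"
          using A7(6) xs by blast
      qed (use measurable_compose[OF \<xi>M Fm] A7(2) \<sigma>xs in auto)
    qed simp
    finally show ?thesis .
  qed

  define sA where "sA n \<omega> x = (1 / real (m (n + 1))) *\<^sub>R (\<Sum>i=1..m (n + 1). f x (\<xi>s (n + 1) i \<omega>))" for n \<omega> x
  define sY where "sY n \<omega> x = closest_point \<X> (x - \<alpha> *\<^sub>R sA n \<omega> x)" for n \<omega> x
  define sB where "sB n \<omega> y = (1 / real (m (n + 1))) *\<^sub>R (\<Sum>i=1..m (n + 1). f y (\<eta>s (n + 1) i \<omega>))" for n \<omega> y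
  define X' where "X' n \<omega> = rec_nat (X 0 \<omega>) (\<lambda>n x. sY n \<omega> x + \<alpha> *\<^sub>R (sA n \<omega> x - sB n \<omega> (sY n \<omega> x))) n" for n \<omega>
  define Y' where "Y' n \<omega> = sY n \<omega> (X' n \<omega>)" for n \<omega>
  have X'0: "X' 0 = X 0" by (simp add: X'_def fun_eq_iff)
  have X'Suc: "X' (Suc n) \<omega> = Y' n \<omega> + \<alpha> *\<^sub>R (sA n \<omega> (X' n \<omega>) - sB n \<omega> (Y' n \<omega>))" for n \<omega>
    by (simp add: X'_def Y'_def)

  have XX': "AE \<omega> in M. \<forall>n. X' n \<omega> = X n \<omega>"
  proof -
    have "AE \<omega> in M. j \<in> ?I \<longrightarrow> samples j \<omega> \<notin> N" for j
    proof (cases "j \<in> ?I")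
      case True
      then have "AE z in distr M S (samples j). z \<notin> N" using NP iid(2) by metis
      then show ?thesis using AE_distrD[OF sm[OF True]] by (simp add: True)
    qed simp
    then have "AE \<omega> in M. \<forall>j. j \<in> ?I \<longrightarrow> samples j \<omega> \<notin> N"
      by (simp add: AE_all_countable)
    moreover have "AE \<omega> in M. \<omega> \<in> space M" by (rule AE_space)
    ultimately show ?thesis
    proof eventually_elim
      fix \<omega> assume g: "\<forall>j. j \<in> ?I \<longrightarrow> samples j \<omega> \<notin> N" and \<omega>: "\<omega> \<in> space M"
      have e: "f x (\<xi>s (n + 1) i \<omega>) = F x (\<xi>s (n + 1) i \<omega>)" "f x (\<eta>s (n + 1) i \<omega>) = F x (\<eta>s (n + 1) i \<omega>)"
        if "i \<in> {1..m (n + 1)}" for x n i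
        using g[rule_format, OF IJ(1)[OF that]] g[rule_format, OF IJ(2)[OF that]] by (simp_all add: f_def smp)
      have A': "sA n \<omega> (X n \<omega>) = A (n + 1) \<omega>" for n
        using SFBF(1) \<omega> e by (simp add: sA_def)
      then have Y'': "sY n \<omega> (X n \<omega>) = Y n \<omega>" for n
        using SFBF(2) \<omega> by (simp add: sY_def)
      have B': "sB n \<omega> (Y n \<omega>) = B (n + 1) \<omega>" for n
        using SFBF(3) \<omega> e by (simp add: sB_def)
      show "\<forall>n. X' n \<omega> = X n \<omega>"
      proof
        fix n show "X' n \<omega> = X n \<omega>"
        proof (induction n)
          case (Suc n)
          then show ?case
            using SFBF(4) \<omega> A'[of n] B'[of n] Y''[of n] by (simp add: X'Suc Y'_def)
        qed (simp add: X'0)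
      qed
    qed
  qed
  have D': "D n = (\<integral>\<^sup>+\<omega>. ennreal ((norm (X' n \<omega> - xs))\<^sup>2) \<partial>M)" for n
    unfolding D_def[rule_format]
  proof (rule nn_integral_cong_AE)
    show "AE \<omega> in M. ennreal ((norm (X n \<omega> - xs))\<^sup>2) = ennreal ((norm (X' n \<omega> - xs))\<^sup>2)"
      using XX' by eventually_elim simp
  qed
  have R': "R n = (\<integral>\<^sup>+\<omega>. ennreal ((residual \<X> T \<alpha> (X' n \<omega>))\<^sup>2) \<partial>M)" for n
    unfolding R_def[rule_format]
  proof (rule nn_integral_cong_AE)
    show "AE \<omega> in M. ennreal ((residual \<X> T \<alpha> (X n \<omega>))\<^sup>2) = ennreal ((residual \<X> T \<alpha> (X' n \<omega>))\<^sup>2)"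
      using XX' by eventually_elim simp
  qed

  \<comment> \<open>All samples of the rounds before \<open>a\<close>, the first \<open>i\<close> samples \<open>\<xi>\<close> and the first \<open>j\<close> samples \<open>\<eta>\<close> of
    round \<open>a\<close>. As samples are numbered from 1, \<open>i = 0\<close> or \<open>j = 0\<close> means none.\<close>
  define K where "K a i j = {k \<in> ?I. case k of Inl (l, q) \<Rightarrow> l < a \<or> l = a \<and> q \<le> i
      | Inr (l, q) \<Rightarrow> l < a \<or> l = a \<and> q \<le> j}" for a i j :: nat
  have KI: "K a i j \<subseteq> ?I" for a i j by (auto simp: K_def)
  have smK: "samples k \<in> measurable M S" if "k \<in> K a i j" for k a i j
    by (rule sm[OF subsetD[OF KI that]])
  define H where "H a i j = history M borel (X 0) S samples (K a i j)" for a i j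
  have Hsub: "subalgebra M (H a i j)" for a i j
    unfolding H_def by (rule subalgebra_history[OF X0(1) smK])
  have Hmono: "subalgebra (H a' i' j') (H a i j)" if "K a i j \<subseteq> K a' i' j'" for a i j a' i' j'
    unfolding H_def by (rule subalgebra_history_mono[OF X0(1) smK that])
  have Hsample: "samples k \<in> measurable (H a i j) S" if "k \<in> K a i j" for k a i j
    unfolding H_def by (rule measurable_history_sample[OF X0(1) smK that])
  have Hfresh: "fresh (H a i j) S (samples k)" if "k \<in> ?I" "k \<notin> K a i j" for k a i j
    unfolding H_def by (rule fresh_history[OF iid(1) X0(1,2) KI that])
  have \<xi>H: "\<xi>s (n + 1) i \<in> measurable (H (n + 1) i' j) S" if "i \<in> {1..m (n + 1)}" "i \<le> i'" for n i i' j
    using Hsample[of "Inl (n + 1, i)" "n + 1" i' j] IJ[OF that(1)] that(2) by (simp add: K_def smp)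
  have \<eta>H: "\<eta>s (n + 1) i \<in> measurable (H (n + 1) i' j) S" if "i \<in> {1..m (n + 1)}" "i \<le> j" for n i i' j
    using Hsample[of "Inr (n + 1, i)" "n + 1" i' j] IJ[OF that(1)] that(2) by (simp add: K_def smp)
  have clm: "closest_point \<X> \<in> borel_measurable borel"
    by (intro borel_measurable_continuous_onI continuous_on_closest_point A2)
  have fcomp: "(\<lambda>\<omega>. f (x \<omega>) (z \<omega>)) \<in> borel_measurable Q"
    if "x \<in> borel_measurable Q" "z \<in> measurable Q S" for x z and Q :: "'a measure"
    using measurable_compose[OF measurable_Pair[OF that] fm] by simp
  have sAm: "(\<lambda>\<omega>. sA n \<omega> (x \<omega>)) \<in> borel_measurable (H (n + 1) (m (n + 1)) j)"
    if "x \<in> borel_measurable (H (n + 1) (m (n + 1)) j)" for n x j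
    unfolding sA_def using \<xi>H
    by (intro borel_measurable_scaleR borel_measurable_const borel_measurable_sum fcomp that) auto
  have sYm: "(\<lambda>\<omega>. sY n \<omega> (x \<omega>)) \<in> borel_measurable (H (n + 1) (m (n + 1)) j)"
    if "x \<in> borel_measurable (H (n + 1) (m (n + 1)) j)" for n x j
    unfolding sY_def
    by (intro measurable_compose[OF _ clm] borel_measurable_diff borel_measurable_scaleR borel_measurable_const that sAm)
  have sBm: "(\<lambda>\<omega>. sB n \<omega> (x \<omega>)) \<in> borel_measurable (H (n + 1) (m (n + 1)) (m (n + 1)))"
    if "x \<in> borel_measurable (H (n + 1) (m (n + 1)) (m (n + 1)))" for n x
    unfolding sB_def using \<eta>H
    by (intro borel_measurable_scaleR borel_measurable_const borel_measurable_sum fcomp that) auto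
  have X'H: "X' n \<in> borel_measurable (H (n + 1) 0 0)" for n
  proof (induction n)
    case 0
    show ?case unfolding X'0 H_def by (rule measurable_history_x0[OF X0(1) smK])
  next
    case (Suc n)
    let ?H = "H (n + 1) (m (n + 1)) (m (n + 1))"
    have "subalgebra ?H (H (n + 1) 0 0)"
      by (rule Hmono) (auto simp: K_def split: sum.splits)
    then have x: "X' n \<in> borel_measurable ?H" using Suc by (rule measurable_from_subalg)
    have "X' (Suc n) \<in> borel_measurable ?H"
      unfolding X'Suc[abs_def] Y'_def
      by (intro borel_measurable_add borel_measurable_scaleR borel_measurable_diff borel_measurable_const
          sAm sYm sBm x)
    moreover have "subalgebra (H (Suc n + 1) 0 0) ?H"
      by (rule Hmono) (auto simp: K_def split: sum.splits)
    ultimately show ?case by (rule measurable_from_subalg[rotated])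
  qed
  have Y'H: "Y' n \<in> borel_measurable (H (n + 1) (m (n + 1)) 0)" for n
  proof -
    have "subalgebra (H (n + 1) (m (n + 1)) 0) (H (n + 1) 0 0)"
      by (rule Hmono) (auto simp: K_def split: sum.splits)
    from measurable_from_subalg[OF this X'H] show ?thesis
      unfolding Y'_def by (rule sYm)
  qed

  have step: "D (Suc n) + ennreal (\<rho> / 2) * R n
      \<le> D n + ennreal (a / real (m (n + 1)) + (a / real (m (n + 1)))\<^sup>2) * (1 + D n)"
    if "D n < \<infinity>" for n
    unfolding D' R' \<rho>_def
  proof (rule sfbf_expected_energy[where f=f and S=S and P="?P" and n=n and m=m and k="m (n + 1)" and \<sigma>="\<sigma> xs"
        and \<sigma>h=\<sigma>hat and ?c1.0=c1
        and H="\<lambda>i. H (n + 1) i 0" and H'="\<lambda>i. H (n + 1) (m (n + 1)) i"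
        and \<xi>="\<xi>s (n + 1)" and \<eta>="\<eta>s (n + 1)" and Y="Y' n"
        and A="\<lambda>\<omega>. sA n \<omega> (X' n \<omega>)" and B="\<lambda>\<omega>. sB n \<omega> (Y' n \<omega>)",
        OF A2(2,3) sol A4 A3 A5(1) \<rho>1 fm mean var])
    show "\<forall>i\<in>{1..m (n + 1)}. fresh (H (n + 1) (i - 1) 0) S (\<xi>s (n + 1) i)"
    proof
      fix i assume i: "i \<in> {1..m (n + 1)}"
      have "Inl (n + 1, i) \<notin> K (n + 1) (i - 1) 0" using i by (auto simp: K_def)
      from Hfresh[OF IJ(1)[OF i] this] show "fresh (H (n + 1) (i - 1) 0) S (\<xi>s (n + 1) i)"
        by (simp only: smp)
    qed
    show "\<forall>i\<in>{1..m (n + 1)}. fresh (H (n + 1) (m (n + 1)) (i - 1)) S (\<eta>s (n + 1) i)"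
    proof
      fix i assume i: "i \<in> {1..m (n + 1)}"
      have "Inr (n + 1, i) \<notin> K (n + 1) (m (n + 1)) (i - 1)" using i by (auto simp: K_def)
      from Hfresh[OF IJ(2)[OF i] this] show "fresh (H (n + 1) (m (n + 1)) (i - 1)) S (\<eta>s (n + 1) i)"
        by (simp only: smp)
    qed
    show "subalgebra (H (n + 1) (Suc i) 0) (H (n + 1) i 0)"
      "subalgebra (H (n + 1) (m (n + 1)) (Suc i)) (H (n + 1) (m (n + 1)) i)" for i
      by (rule Hmono, auto simp: K_def split: sum.splits)+
    show "\<forall>i\<in>{1..m (n + 1)}. distr M S (\<xi>s (n + 1) i) = ?P"
      "\<forall>i\<in>{1..m (n + 1)}. distr M S (\<eta>s (n + 1) i) = ?P"
      using iid(2) IJ smp by metis+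
    show "X' (Suc n) \<in> borel_measurable M"
      by (rule measurable_from_subalg[OF Hsub X'H])
    show "(\<integral>\<^sup>+\<omega>. ennreal ((norm (X' n \<omega> - xs))\<^sup>2) \<partial>M) < \<infinity>" using that by (simp add: D')
    show "X' (Suc n) \<omega> = Y' n \<omega> + \<alpha> *\<^sub>R (sA n \<omega> (X' n \<omega>) - sB n \<omega> (Y' n \<omega>))" for \<omega> by (rule X'Suc)
    show "Y' n \<omega> = closest_point \<X> (X' n \<omega> - \<alpha> *\<^sub>R sA n \<omega> (X' n \<omega>))" for \<omega> by (simp add: Y'_def sY_def)
    show "sA n \<omega> (X' n \<omega>) = (1 / real (m (n + 1))) *\<^sub>R (\<Sum>i=1..m (n + 1). f (X' n \<omega>) (\<xi>s (n + 1) i \<omega>))" for \<omega>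
      by (simp add: sA_def)
    show "sB n \<omega> (Y' n \<omega>) = (1 / real (m (n + 1))) *\<^sub>R (\<Sum>i=1..m (n + 1). f (Y' n \<omega>) (\<eta>s (n + 1) i \<omega>))" for \<omega>
      by (simp add: sB_def)
  qed (use \<sigma>xs A7(2) c1 C2pos mpos \<xi>H \<eta>H Hsub X'H Y'H in \<open>auto simp: \<sigma>hat_def a_def\<close>)

  have a0: "a \<ge> 0" using c1(1) by (simp add: a_def)
  have \<rho>0: "\<rho> > 0" using \<rho>1 by (simp add: \<rho>_def)
  note bound = hitting_index_bound[OF \<rho>0 a0 \<phi>(1) \<phi>1 \<epsilon> A6(2) step]
  show "(D 0 < \<infinity> \<longrightarrow> hitting_index R \<epsilon> < \<infinity>) \<and>
      (\<forall>N. hitting_index R \<epsilon> = enat N \<longrightarrow>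
         N = 0 \<or>
         (R N \<le> ennreal \<epsilon> \<and> ennreal \<epsilon> < Lambda_sup \<rho> a m D \<phi> / of_nat N))"
    using bound hitting_index_enat(1) by blast
qed

end
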